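(* Let $\gamma>0$ and let $0<2\alpha<\beta<1$. Let $K$ be a kernel for which there exists $C_K<\infty$ such that $K(y,x)=0$ for $|x-y|>C_K$ and such that $K(y,x)=K(y-k,x-k)$ for all $k\in\mathbb{Z}$ and $x,y\in\mathbb{R}$. Then there exist $\underline j_{K,\gamma}$, $C_{K,\gamma,*}>0$ and $\eta_{K,\gamma}>0$ (depending only on $K$ and $\gamma$) such that, for any $0<\underline B\le B\le\overline B$, any $0<\varepsilon\le\varepsilon'<\eta_{K,\gamma}$ and any integer $\underline\ell\ge\underline j_{K,\gamma}$, $$R^*_{n,\alpha,\beta}\Big(\mathcal{F}_{\text{self-sim}}(\gamma,B,\varepsilon';K,\underline\ell),\ \bigcup_{B'\in[\underline B,\overline B]}\mathcal{F}_{\text{self-sim}}(\gamma,B',\varepsilon;K,\underline\ell)\Big)\ \ge\ (1+o(1))\,C_{K,\gamma,*}\,\min\{\varepsilon^{-1}B,\overline B\}^{1/(2\gamma+1)}\left(\sigma_n^2\log(1/\sigma_n)\right)^{\gamma/(2\gamma+1)},$$ where $o(1)$ denotes a term tending to $0$ as $n\to\infty$ with all other quantities held fixed.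
   Context: White noise model: one observes $Y(t)=\int_0^t f(s)\,ds+\sigma_n W(t)$ for $t\in[-\eta,1+\eta]$ (some fixed $\eta>0$), where $f:\mathbb{R}\to\mathbb{R}$ is unknown, $W$ is a standard (two-sided) Brownian motion, and $\sigma_n=\sigma/\sqrt n$ is known, with $\sigma>0$ fixed. $P_f$ denotes probability when $Y$ is generated by $f$. H\"older class: for $\gamma,B>0$, with $\lfloor\gamma\rfloor$ the greatest integer strictly less than $\gamma$, $\mathcal{F}_{\text{H\"ol}}(\gamma,B)$ is the set of ($\lfloor\gamma\rfloor$ times differentiable) $f:\mathbb{R}\to\mathbb{R}$ with $|f^{(\lfloor\gamma\rfloor)}(t)-f^{(\lfloor\gamma\rfloor)}(t')|\le B|t-t'|^{\gamma-\lfloor\gamma\rfloor}$ for all $t,t'\in\mathbb{R}$. Kernel: a function $K:\mathbb{R}^2\to\mathbb{R}$ such that $x\mapsto K(t,x)$ is of bounded variation for each $t$. For an integer $j$, $K_j(t,x)=2^jK(2^jt,2^jx)$ and $K_jf(t)=\int K_j(t,x)f(x)\,dx$. Self-similarity class: for $\gamma,B,\varepsilon>0$ and integer $\underline\ell$, $\mathcal{F}_{\text{self-sim}}(\gamma,B,\varepsilon;K,\underline\ell)$ is the set of $f\in\mathcal{F}_{\text{H\"ol}}(\gamma,B)$ such that $\sup_{t\in[0,1]}|K_jf(t)-f(t)|\ge\varepsilon B2^{-j\gamma}$ for all integers $j\ge\underline\ell$. Confidence bands: a confidence band $\mathcal{C}_n(\cdot)$ is a collection of random intervals $\mathcal{C}_n(x)=\mathcal{C}_n(x;Y)$,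 $x\in[0,1]$, depending on the data $Y$ at noise level $\sigma_n$. $\mathcal{I}_{n,\alpha,\mathcal{F}}$ is the set of confidence bands with $\inf_{f\in\mathcal{F}}P_f(f(x)\in\mathcal{C}_n(x)\text{ for all }x\in[0,1])\ge1-\alpha$. With $\mathrm{length}(\mathcal{A})=\sup\mathcal{A}-\inf\mathcal{A}$ and $q_{\beta,f}$ the $\beta$ quantile under $P_f$, let $R_\beta(\mathcal{C}_n;\mathcal{G})=\sup_{f\in\mathcal{G}}q_{\beta,f}\big(\sup_{x\in[0,1]}\mathrm{length}(\mathcal{C}_n(x))\big)$, and $R^*_{n,\alpha,\beta}(\mathcal{G},\mathcal{F})=\inf_{\mathcal{C}_n(\cdot)\in\mathcal{I}_{n,\alpha,\mathcal{F}}}R_\beta(\mathcal{C}_n;\mathcal{G})$. *)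

theory Defs
  imports "HOL-Probability.Probability"
begin

section \<open>Function classes\<close>

text \<open>The greatest integer strictly less than \<open>\<gamma>\<close> (so \<open>strict_floor 1 = 0\<close>).\<close>
definition strict_floor :: "real \<Rightarrow> nat" where
  "strict_floor \<gamma> = nat (\<lceil>\<gamma>\<rceil> - 1)"

definition holder_class :: "real \<Rightarrow> real \<Rightarrow> (real \<Rightarrow> real) set" where
  "holder_class \<gamma> B = {f.
     (\<forall>k < strict_floor \<gamma>. \<forall>t. ((deriv ^^ k) f) differentiable (at t)) \<and>
     (\<forall>t t'. \<bar>(deriv ^^ strict_floor \<gamma>) f t - (deriv ^^ strict_floor \<gamma>) f t'\<bar>
               \<le> B * \<bar>t - t'\<bar> powr (\<gamma> - real (strict_floor \<gamma>)))}"

text \<open>Bounded variation over the whole real line.\<close>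
definition bounded_variation :: "(real \<Rightarrow> real) \<Rightarrow> bool" where
  "bounded_variation g \<longleftrightarrow>
     (\<exists>V. \<forall>(m::nat) (x :: nat \<Rightarrow> real). mono x \<longrightarrow>
        (\<Sum>i<m. \<bar>g (x (Suc i)) - g (x i)\<bar>) \<le> V)"

definition kernel :: "(real \<Rightarrow> real \<Rightarrow> real) \<Rightarrow> bool" where
  "kernel K \<longleftrightarrow> (\<forall>t. bounded_variation (\<lambda>x. K t x))"

definition scaled_kernel :: "(real \<Rightarrow> real \<Rightarrow> real) \<Rightarrow> int \<Rightarrow> real \<Rightarrow> real \<Rightarrow> real" where
  "scaled_kernel K j t x = 2 powi j * K (2 powi j * t) (2 powi j * x)"

definition kernel_op :: "(real \<Rightarrow> real \<Rightarrow> real) \<Rightarrow> int \<Rightarrow> (real \<Rightarrow> real) \<Rightarrow> real \<Rightarrow> real" where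
  "kernel_op K j f t = (LINT x|lborel. scaled_kernel K j t x * f x)"

text \<open>The supremum is taken in the extended reals: no regularity of \<open>K\<close> in its first
  argument is assumed, so the supremum may be infinite.\<close>
definition self_sim_class ::
  "real \<Rightarrow> real \<Rightarrow> real \<Rightarrow> (real \<Rightarrow> real \<Rightarrow> real) \<Rightarrow> int \<Rightarrow> (real \<Rightarrow> real) set" where
  "self_sim_class \<gamma> B \<epsilon> K l = {f \<in> holder_class \<gamma> B.
     \<forall>j \<ge> l. (SUP t\<in>{0..1}. ereal \<bar>kernel_op K j f t - f t\<bar>)
               \<ge> ereal (\<epsilon> * B * 2 powr (- (of_int j * \<gamma>)))}"

section \<open>The white noise model\<close>

definition two_sided_brownian_motion :: "'a measure \<Rightarrow> (real \<Rightarrow> 'a \<Rightarrow> real) \<Rightarrow> bool" where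
  "two_sided_brownian_motion M W \<longleftrightarrow>
     prob_space M \<and>
     (\<forall>t. W t \<in> borel_measurable M) \<and>
     (\<forall>\<omega>\<in>space M. W 0 \<omega> = 0) \<and>
     (\<forall>\<omega>\<in>space M. continuous_on UNIV (\<lambda>t. W t \<omega>)) \<and>
     (\<forall>s t. s < t \<longrightarrow>
        distributed M lborel (\<lambda>\<omega>. W t \<omega> - W s \<omega>) (normal_density 0 (sqrt (t - s)))) \<and>
     (\<forall>(m::nat) (t :: nat \<Rightarrow> real). mono t \<longrightarrow>
        prob_space.indep_vars M (\<lambda>_. borel)
          (\<lambda>i \<omega>. W (t (Suc i)) \<omega> - W (t i) \<omega>) {..<m})"

text \<open>Data space: the continuous functions on \<open>[-\<eta>, 1+\<eta>]\<close>, represented as extensional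
  functions (value \<open>undefined\<close> outside the interval), with the sigma-algebra generated by
  the coordinate maps.\<close>
definition path_space :: "real \<Rightarrow> (real \<Rightarrow> real) measure" where
  "path_space \<eta> = restrict_space (PiM {-\<eta>..1+\<eta>} (\<lambda>_. borel))
                     {y. continuous_on {-\<eta>..1+\<eta>} y}"

text \<open>For \<open>t < 0\<close> the oriented integral \<open>LBINT s=0..t\<close> is minus the integral over \<open>[t, 0]\<close>.\<close>
definition wn_data ::
  "(real \<Rightarrow> 'a \<Rightarrow> real) \<Rightarrow> real \<Rightarrow> real \<Rightarrow> (real \<Rightarrow> real) \<Rightarrow> 'a \<Rightarrow> (real \<Rightarrow> real)" where
  "wn_data W \<eta> s f \<omega> = (\<lambda>t\<in>{-\<eta>..1+\<eta>}. (LBINT u=ereal 0..ereal t. f u) + s * W t \<omega>)"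

text \<open>The completed law of the data at regression function \<open>f\<close> and noise level \<open>s\<close>.\<close>
definition wn_law ::
  "'a measure \<Rightarrow> (real \<Rightarrow> 'a \<Rightarrow> real) \<Rightarrow> real \<Rightarrow> real \<Rightarrow> (real \<Rightarrow> real) \<Rightarrow> (real \<Rightarrow> real) measure" where
  "wn_law M W \<eta> s f = completion (distr M (path_space \<eta>) (wn_data W \<eta> s f))"

section \<open>Confidence bands and minimax length\<close>

text \<open>A band maps the data \<open>y\<close> and a point \<open>x\<close> to a set of reals.\<close>
type_synonym band = "(real \<Rightarrow> real) \<Rightarrow> real \<Rightarrow> real set"

definition set_length :: "real set \<Rightarrow> ereal" where
  "set_length A = Sup (ereal ` A) - Inf (ereal ` A)"

definition max_length :: "band \<Rightarrow> (real \<Rightarrow> real) \<Rightarrow> ereal" where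
  "max_length C y = (SUP x\<in>{0..1}. set_length (C y x))"

definition cover_event :: "real \<Rightarrow> band \<Rightarrow> (real \<Rightarrow> real) \<Rightarrow> (real \<Rightarrow> real) set" where
  "cover_event \<eta> C f = {y \<in> space (path_space \<eta>). \<forall>x\<in>{0..1}. f x \<in> C y x}"

text \<open>The intervals may be open, closed, half-open, unbounded, degenerate or empty.  The only
  measurability imposed is that of the events and random variables whose probabilities and
  quantiles are taken.\<close>
definition conf_bands ::
  "'a measure \<Rightarrow> (real \<Rightarrow> 'a \<Rightarrow> real) \<Rightarrow> real \<Rightarrow> real \<Rightarrow> real \<Rightarrow> (real \<Rightarrow> real) set \<Rightarrow> band set" where
  "conf_bands M W \<eta> s \<alpha> F = {C.
     (\<forall>y\<in>space (path_space \<eta>). \<forall>x\<in>{0..1}. is_interval (C y x)) \<and>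
     (\<forall>f\<in>F. cover_event \<eta> C f \<in> sets (wn_law M W \<eta> s f)) \<and>
     (\<forall>f\<in>F. max_length C \<in> borel_measurable (wn_law M W \<eta> s f)) \<and>
     (INF f\<in>F. ereal (measure (wn_law M W \<eta> s f) (cover_event \<eta> C f))) \<ge> ereal (1 - \<alpha>)}"

definition quantile :: "'b measure \<Rightarrow> real \<Rightarrow> ('b \<Rightarrow> ereal) \<Rightarrow> ereal" where
  "quantile P \<beta> X = Inf {q. measure P {y \<in> space P. X y \<le> q} \<ge> \<beta>}"

definition worst_length ::
  "'a measure \<Rightarrow> (real \<Rightarrow> 'a \<Rightarrow> real) \<Rightarrow> real \<Rightarrow> real \<Rightarrow> real \<Rightarrow> band \<Rightarrow> (real \<Rightarrow> real) set \<Rightarrow> ereal" where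
  "worst_length M W \<eta> s \<beta> C G = (SUP f\<in>G. quantile (wn_law M W \<eta> s f) \<beta> (max_length C))"

definition minimax_length ::
  "'a measure \<Rightarrow> (real \<Rightarrow> 'a \<Rightarrow> real) \<Rightarrow> real \<Rightarrow> real \<Rightarrow> real \<Rightarrow> real \<Rightarrow>
     (real \<Rightarrow> real) set \<Rightarrow> (real \<Rightarrow> real) set \<Rightarrow> ereal" where
  "minimax_length M W \<eta> s \<alpha> \<beta> G F =
     (INF C\<in>conf_bands M W \<eta> s \<alpha> F. worst_length M W \<eta> s \<beta> C G)"

end

theory Submission
  imports Defs "HOL-Real_Asymp.Real_Asymp"
begin

text \<open>
  A lacunary sum of disjoint bumps, one for each dyadic scale, gives a function \<open>f\<close> of smoothness
  constant \<open>B / 2\<close> whose bias at scale \<open>j\<close> is at least \<open>\<kappa> B 2 powr (- j \<gamma>)\<close>, attained at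
  points of \<open>[0, 1/2]\<close>.  Put \<open>T = min (\<kappa> B / \<epsilon>) Bu\<close>.  Adding to \<open>f\<close> a bump \<open>g k\<close> of width
  \<open>h\<close> and smoothness constant \<open>T / 2\<close>, supported in \<open>[1/2, 1]\<close>, does not change the bias at these
  points, and \<open>\<kappa> B \<ge> \<epsilon> T\<close>, so that \<open>f + g k\<close> is self-similar with constant \<open>T\<close>.  There are of
  order \<open>1 / h\<close> disjoint choices of the bump.  If \<open>h\<close> is a small enough multiple of
  \<open>(s\<^sup>2 ln (1 / s) / T\<^sup>2) powr (1 / (2 \<gamma> + 1))\<close>, the \<open>\<chi>\<^sup>2\<close> distance between the uniform mixture of
  the laws under \<open>f + g k\<close> and the law under \<open>f\<close> tends to \<open>0\<close>.  Hence, with probability at least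
  \<open>1 - 2 \<alpha> - o(1)\<close> under \<open>f\<close>, the band covers both \<open>f\<close> and some \<open>f + g k\<close>, and is then at
  least as long as the height of the bump, which is of order \<open>T h powr \<gamma>\<close>.
\<close>

section \<open>Gaussian shift mixtures\<close>

text \<open>\<open>T\<close> is the largest smoothness constant with \<open>T \<le> Bu\<close> and
  \<open>\<epsilon> * T \<le> \<kappa> * B\<close>; this is the source of the minimum in the bound.
  As \<open>B \<le> T\<close>, the halves \<open>B / 2\<close> and \<open>T / 2\<close> add up to at
  most \<open>T\<close>. The logarithm comes from the number of bumps: the chi-square distance is at
  most \<open>exp E / n\<close> for \<open>n\<close> bumps of energy \<open>E\<close> relative to
  the noise, so \<open>E\<close> may grow like a small multiple of \<open>ln (1 / s)\<close>. One
  \<open>\<alpha>\<close> is lost for covering \<open>f\<close> and one for covering a perturbed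
  function, hence \<open>2 * \<alpha> < \<beta>\<close>. The obstacle is that the data are paths and
  that bands are measurable only for completed laws. The mixture inequality is therefore proved for
  finitely many coordinates with a bound that does not depend on them, extended by approximation in
  measure, and applied to inner approximations of the coverage events. For the bias, integer shifts
  reduce \<open>K\<close> at \<open>p\<close> to \<open>K 0\<close>, and a narrow enough bump has a
  kernel average of at most half its height, whereas its value at the centre is the full
  height.\<close>

lemma PiM_density:
  fixes N :: "'i \<Rightarrow> 'a measure" and f :: "'i \<Rightarrow> 'a \<Rightarrow> ennreal"
  assumes "finite I" and N: "\<And>i. prob_space (N i)"
    and f [measurable]: "\<And>i. f i \<in> borel_measurable (N i)"
    and Nf: "\<And>i. prob_space (density (N i) (f i))"
  shows "(\<Pi>\<^sub>M i\<in>I. density (N i) (f i)) = density (\<Pi>\<^sub>M i\<in>I. N i) (\<lambda>x. \<Prod>i\<in>I. f i (x i))"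
proof -
  interpret P: product_prob_space N
    by (simp add: product_prob_space_def product_prob_space_axioms_def product_sigma_finite_def
        N prob_space_imp_sigma_finite)
  interpret Q: product_prob_space "\<lambda>i. density (N i) (f i)"
    by (simp add: product_prob_space_def product_prob_space_axioms_def product_sigma_finite_def
        Nf prob_space_imp_sigma_finite)
  show ?thesis
  proof (rule Q.PiM_eqI[symmetric])
    show "finite I" by fact
    show "sets (density (\<Pi>\<^sub>M i\<in>I. N i) (\<lambda>x. \<Prod>i\<in>I. f i (x i)))
        = sets (\<Pi>\<^sub>M i\<in>I. density (N i) (f i))"
      by (simp cong: sets_PiM_cong)
    fix A assume "\<And>i. i \<in> I \<Longrightarrow> A i \<in> sets (density (N i) (f i))"
    then have A: "A i \<in> sets (N i)" if "i \<in> I" for i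
      using that by simp
    have "emeasure (density (\<Pi>\<^sub>M i\<in>I. N i) (\<lambda>x. \<Prod>i\<in>I. f i (x i))) (Pi\<^sub>E I A)
        = (\<integral>\<^sup>+x. (\<Prod>i\<in>I. f i (x i)) * indicator (Pi\<^sub>E I A) x \<partial>(\<Pi>\<^sub>M i\<in>I. N i))"
      using A \<open>finite I\<close> by (intro emeasure_density) (auto intro!: sets_PiM_I_finite)
    also have "\<dots> = (\<integral>\<^sup>+x. (\<Prod>i\<in>I. f i (x i) * indicator (A i) (x i)) \<partial>(\<Pi>\<^sub>M i\<in>I. N i))"
    proof (intro nn_integral_cong)
      fix x assume "x \<in> space (Pi\<^sub>M I N)"
      then have "x \<in> Pi\<^sub>E I A \<longleftrightarrow> (\<forall>i\<in>I. x i \<in> A i)"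
        by (auto simp: space_PiM PiE_iff)
      then have "indicator (Pi\<^sub>E I A) x = (\<Prod>i\<in>I. indicator (A i) (x i) :: ennreal)"
        using \<open>finite I\<close> by (auto simp: indicator_def)
      then show "(\<Prod>i\<in>I. f i (x i)) * indicator (Pi\<^sub>E I A) x
          = (\<Prod>i\<in>I. f i (x i) * indicator (A i) (x i))"
        by (simp add: prod.distrib)
    qed
    also have "\<dots> = (\<Prod>i\<in>I. \<integral>\<^sup>+x. f i x * indicator (A i) x \<partial>N i)"
      using A \<open>finite I\<close> by (intro P.product_nn_integral_prod) auto
    also have "\<dots> = (\<Prod>i\<in>I. emeasure (density (N i) (f i)) (A i))"
      using A by (intro prod.cong refl emeasure_density[symmetric]) auto
    finally show "emeasure (density (\<Pi>\<^sub>M i\<in>I. N i) (\<lambda>x. \<Prod>i\<in>I. f i (x i))) (Pi\<^sub>E I A)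
        = (\<Prod>i\<in>I. emeasure (density (N i) (f i)) (A i))" .
  qed
qed

definition gauss :: "real \<Rightarrow> real \<Rightarrow> real measure" where
  "gauss \<mu> v = density lborel (normal_density \<mu> v)"

text \<open>The likelihood ratio of the normal law with mean \<open>\<mu> + a\<close> against the
  one with mean \<open>\<mu>\<close>; \<open>v\<close> is their common standard deviation, not a
  variance.\<close>

definition tilt :: "real \<Rightarrow> real \<Rightarrow> real \<Rightarrow> real \<Rightarrow> real" where
  "tilt \<mu> v a x = exp (a * (x - \<mu>) / v\<^sup>2 - a\<^sup>2 / (2 * v\<^sup>2))"

lemma sets_gauss [simp, measurable_cong]: "sets (gauss \<mu> v) = sets borel"
  by (simp add: gauss_def)

lemma prob_space_gauss: "v > 0 \<Longrightarrow> prob_space (gauss \<mu> v)"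
  by (simp add: gauss_def prob_space_normal_density)

lemma measurable_tilt [measurable]: "tilt \<mu> v a \<in> borel_measurable borel"
  by (simp add: tilt_def[abs_def])

lemma normal_density_tilt:
  assumes "v > 0"
  shows "normal_density \<mu> v x * tilt \<mu> v a x = normal_density (\<mu> + a) v x"
proof -
  have "- (x - \<mu>)\<^sup>2 / (2 * v\<^sup>2) + (a * (x - \<mu>) / v\<^sup>2 - a\<^sup>2 / (2 * v\<^sup>2))
      = - (x - (\<mu> + a))\<^sup>2 / (2 * v\<^sup>2)"
    using assms by (simp add: field_simps power2_eq_square)
  then show ?thesis
    by (simp add: normal_density_def tilt_def mult.assoc flip: exp_add)
qed

text \<open>Completing the square. As a tilt has mean 1, the factor
  \<open>exp (a * b / v\<^sup>2)\<close> is the mixed second moment of two likelihood ratios; it is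
  1 as soon as one of the shifts vanishes.\<close>

lemma tilt_mult:
  assumes "v > 0"
  shows "tilt \<mu> v a x * tilt \<mu> v b x = exp (a * b / v\<^sup>2) * tilt \<mu> v (a + b) x"
  using assms by (simp add: tilt_def field_simps power2_eq_square flip: exp_add)

lemma has_bochner_integral_tilt:
  assumes "v > 0"
  shows "has_bochner_integral (gauss \<mu> v) (tilt \<mu> v a) 1"
proof -
  have "has_bochner_integral lborel (\<lambda>x. normal_density \<mu> v x *\<^sub>R tilt \<mu> v a x) 1"
    using assms
    by (simp add: normal_density_tilt has_bochner_integral_iff)
  then show ?thesis
    unfolding gauss_def by (intro has_bochner_integral_density) auto
qed

lemma density_gauss_tilt:
  assumes "v > 0"
  shows "density (gauss \<mu> v) (tilt \<mu> v a) = gauss (\<mu> + a) v"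
  using assms unfolding gauss_def
  by (subst density_density_eq)
     (auto simp: normal_density_tilt simp flip: ennreal_mult' intro!: density_cong)

text \<open>A second-moment bound: the mean likelihood ratio \<open>(\<Sum>k<n. L k) / n\<close> has
  expectation \<open>1\<close> and, because distinct shifts are orthogonal, second moment at most
  \<open>1 + exp A / n\<close>.\<close>
lemma gauss_shift_mixture:
  fixes a :: "nat \<Rightarrow> 'i \<Rightarrow> real"
  assumes I: "finite I" and v: "\<And>i. v i > 0" and n: "n > 0"
    and orth: "\<And>k l i. k < n \<Longrightarrow> l < n \<Longrightarrow> k \<noteq> l \<Longrightarrow> i \<in> I \<Longrightarrow> a k i * a l i = 0"
    and energy: "\<And>k. k < n \<Longrightarrow> (\<Sum>i\<in>I. (a k i)\<^sup>2 / (v i)\<^sup>2) \<le> A"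
    and \<delta>: "\<delta> > 0" "exp A \<le> real n * \<delta>\<^sup>2"
    and X: "X \<in> sets (\<Pi>\<^sub>M i\<in>I. borel)"
  shows "(\<Sum>k<n. measure (\<Pi>\<^sub>M i\<in>I. gauss (\<mu> i + a k i) (v i)) X) / real n
           \<le> measure (\<Pi>\<^sub>M i\<in>I. gauss (\<mu> i) (v i)) X + \<delta>"
proof -
  let ?N = "\<lambda>i. gauss (\<mu> i) (v i)"
  define P where "P = Pi\<^sub>M I ?N"
  define L where "L k x = (\<Prod>i\<in>I. tilt (\<mu> i) (v i) (a k i) (x i))" for k x
  interpret P: product_prob_space ?N
    by (simp add: product_prob_space_def product_prob_space_axioms_def product_sigma_finite_def
        v prob_space_gauss prob_space_imp_sigma_finite)
  interpret PP: prob_space P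
    unfolding P_def by (intro prob_space_PiM prob_space_gauss v)
  have sets_P [measurable_cong]: "sets P = sets (\<Pi>\<^sub>M i\<in>I. borel)"
    unfolding P_def by (intro sets_PiM_cong) simp_all
  note X [measurable]
  have L_meas [measurable]: "L k \<in> borel_measurable P" for k
    unfolding L_def[abs_def] P_def by measurable
  have L_nonneg: "L k x \<ge> 0" for k x
    by (simp add: L_def prod_nonneg tilt_def)
  have L_int: "has_bochner_integral P (L k) 1" for k
  proof -
    have "integrable (?N i) (tilt (\<mu> i) (v i) (a k i))"
      "integral\<^sup>L (?N i) (tilt (\<mu> i) (v i) (a k i)) = 1" for i
      using has_bochner_integral_tilt[OF v[of i], of "\<mu> i"] by (auto simp: has_bochner_integral_iff)
    then show ?thesis
      unfolding has_bochner_integral_iff L_def P_def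
      using P.product_integral_prod[OF I, of "\<lambda>i. tilt (\<mu> i) (v i) (a k i)"]
        P.product_integrable_prod[OF I, of "\<lambda>i. tilt (\<mu> i) (v i) (a k i)"] by auto
  qed
  have LL_int: "has_bochner_integral P (\<lambda>x. L k x * L l x)
      (exp (\<Sum>i\<in>I. a k i * a l i / (v i)\<^sup>2))" for k l
  proof -
    let ?f = "\<lambda>i x. exp (a k i * a l i / (v i)\<^sup>2) * tilt (\<mu> i) (v i) (a k i + a l i) x"
    have *: "integrable (?N i) (?f i)"
      "integral\<^sup>L (?N i) (?f i) = exp (a k i * a l i / (v i)\<^sup>2)" for i
      using has_bochner_integral_tilt[OF v[of i], of "\<mu> i"] by (auto simp: has_bochner_integral_iff)
    have **: "L k x * L l x = (\<Prod>i\<in>I. ?f i (x i))" for x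
      by (simp add: L_def v tilt_mult flip: prod.distrib)
    show ?thesis
      unfolding has_bochner_integral_iff ** P_def exp_sum[OF I]
      using P.product_integral_prod[OF I, of ?f] P.product_integrable_prod[OF I, of ?f] * by auto
  qed
  have shifted: "(\<Pi>\<^sub>M i\<in>I. gauss (\<mu> i + a k i) (v i)) = density P (L k)" for k
  proof -
    have "(\<Pi>\<^sub>M i\<in>I. density (?N i) (tilt (\<mu> i) (v i) (a k i)))
        = density P (\<lambda>x. \<Prod>i\<in>I. ennreal (tilt (\<mu> i) (v i) (a k i) (x i)))"
      unfolding P_def
      by (rule PiM_density[OF I]) (auto simp: v density_gauss_tilt prob_space_gauss)
    also have "\<dots> = density P (L k)"
      by (simp add: L_def prod_ennreal tilt_def)
    finally show ?thesis
      by (simp add: density_gauss_tilt v)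
  qed
  have mean: "measure (\<Pi>\<^sub>M i\<in>I. gauss (\<mu> i + a k i) (v i)) X
      = (\<integral>x. L k x * indicator X x \<partial>P)" for k
  proof -
    have "emeasure (density P (L k)) X = (\<integral>\<^sup>+x. ennreal (L k x * indicator X x) \<partial>P)"
      by (subst emeasure_density) (auto intro!: nn_integral_cong simp: indicator_def)
    also have "\<dots> = ennreal (\<integral>x. L k x * indicator X x \<partial>P)"
      using L_int[of k] L_nonneg
      by (intro nn_integral_eq_integral)
        (auto simp: has_bochner_integral_iff intro!: integrable_real_mult_indicator)
    finally show ?thesis
      using L_nonneg by (simp add: shifted measure_def)
  qed
  \<comment> \<open>The mean likelihood ratio minus 1; its second moment under \<open>P\<close> is
    the chi-square distance of the mixture from \<open>P\<close>.\<close>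
  define D where "D x = (\<Sum>k<n. L k x) / real n - 1" for x
  have sq: "(D x)\<^sup>2 = (\<Sum>k<n. \<Sum>l<n. L k x * L l x) / (real n)\<^sup>2 - 2 * (\<Sum>k<n. L k x) / real n + 1" for x
    by (simp add: D_def power2_diff power_divide flip: sum_product power2_eq_square)
  have L_i: "integrable P (L k)" "integral\<^sup>L P (L k) = 1" for k
    using L_int by (auto simp: has_bochner_integral_iff)
  have LL_i: "integrable P (\<lambda>x. L k x * L l x)"
    "(\<integral>x. L k x * L l x \<partial>P) = exp (\<Sum>i\<in>I. a k i * a l i / (v i)\<^sup>2)" for k l
    using LL_int by (auto simp: has_bochner_integral_iff)
  have D_int: "integrable P D"
    unfolding D_def[abs_def] using L_i by auto
  have D2_int: "integrable P (\<lambda>x. (D x)\<^sup>2)"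
    unfolding sq using L_i LL_i by auto
  \<comment> \<open>On the diagonal the exponent is the energy of one shift; off it, orthogonality
    makes the exponent 0. The 1 added to every entry sums to the square of \<open>n\<close> and
    cancels against the \<open>- 1\<close> in the second moment of \<open>D\<close>.\<close>
  have cross: "exp (\<Sum>i\<in>I. a k i * a l i / (v i)\<^sup>2) \<le> (if k = l then exp A else 0) + 1"
    if "k < n" "l < n" for k l
  proof (cases "k = l")
    case True
    then show ?thesis
      using energy[OF that(1)] by (simp add: power2_eq_square add_increasing2)
  next
    case False
    then have "(\<Sum>i\<in>I. a k i * a l i / (v i)\<^sup>2) = 0"
      using orth[OF that] by (intro sum.neutral) auto
    then show ?thesis
      by simp
  qed
  have "(\<integral>x. (D x)\<^sup>2 \<partial>P)
      = (\<Sum>k<n. \<Sum>l<n. exp (\<Sum>i\<in>I. a k i * a l i / (v i)\<^sup>2)) / (real n)\<^sup>2 - 1"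
    unfolding sq using L_i LL_i n by (simp add: integral_sum PP.prob_space)
  also have "(\<Sum>k<n. \<Sum>l<n. exp (\<Sum>i\<in>I. a k i * a l i / (v i)\<^sup>2))
      \<le> (\<Sum>k<n. \<Sum>l<n. (if k = l then exp A else 0) + 1)"
    using cross by (intro sum_mono) auto
  also have "\<dots> = real n * exp A + (real n)\<^sup>2"
    by (simp add: sum.distrib power2_eq_square algebra_simps)
  finally have D2: "(\<integral>x. (D x)\<^sup>2 \<partial>P) \<le> exp A / real n"
    using n by (simp add: field_simps power2_eq_square)
  have LX_i: "integrable P (\<lambda>x. L k x * indicator X x)" for k
    using L_i X by (intro integrable_real_mult_indicator) (auto simp: sets_P)
  have mix_i: "integrable P (\<lambda>x. (\<Sum>k<n. L k x * indicator X x) / real n)"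
    by (intro Bochner_Integration.integrable_sum integrable_divide LX_i)
  have X_i: "integrable P (indicator X :: _ \<Rightarrow> real)" "integral\<^sup>L P (indicator X) = measure P X"
    using X by (auto simp: sets_P PP.emeasure_eq_measure)
  have "(\<integral>x. (\<Sum>k<n. L k x * indicator X x) / real n - indicator X x \<partial>P)
      = (\<integral>x. (\<Sum>k<n. L k x * indicator X x) / real n \<partial>P) - measure P X"
    unfolding X_i(2)[symmetric] by (rule Bochner_Integration.integral_diff[OF mix_i X_i(1)])
  also have "(\<integral>x. (\<Sum>k<n. L k x * indicator X x) / real n \<partial>P)
      = (\<Sum>k<n. \<integral>x. L k x * indicator X x \<partial>P) / real n"
    by (subst integral_divide_zero, subst Bochner_Integration.integral_sum) (rule LX_i refl)+
  finally have "(\<Sum>k<n. measure (\<Pi>\<^sub>M i\<in>I. gauss (\<mu> i + a k i) (v i)) X) / real n - measure P X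
      = (\<integral>x. (\<Sum>k<n. L k x * indicator X x) / real n - indicator X x \<partial>P)"
    unfolding mean ..
  \<comment> \<open>Young's inequality with weight \<open>\<delta>\<close> stands in for
    Cauchy-Schwarz; each of its two terms contributes at most \<open>\<delta> / 2\<close>.\<close>
  also have "\<dots> \<le> (\<integral>x. \<delta> / 2 + (D x)\<^sup>2 / (2 * \<delta>) \<partial>P)"
  proof (rule integral_mono)
    show "integrable P (\<lambda>x. (\<Sum>k<n. L k x * indicator X x) / real n - indicator X x)"
      by (rule Bochner_Integration.integrable_diff[OF mix_i X_i(1)])
    show "integrable P (\<lambda>x. \<delta> / 2 + (D x)\<^sup>2 / (2 * \<delta>))"
      using D2_int by simp
    fix x
    have "(\<Sum>k<n. L k x * indicator X x) / real n - indicator X x = D x * indicator X x"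
      by (simp add: D_def indicator_def)
    also have "\<dots> \<le> \<bar>D x\<bar>"
      by (simp add: indicator_def abs_ge_self)
    also have "\<dots> \<le> \<delta> / 2 + (D x)\<^sup>2 / (2 * \<delta>)"
    proof -
      have "0 \<le> (\<delta> - \<bar>D x\<bar>)\<^sup>2" by simp
      then have "2 * \<delta> * \<bar>D x\<bar> \<le> \<delta>\<^sup>2 + (D x)\<^sup>2"
        by (simp add: power2_diff)
      then show ?thesis
        using \<delta> by (simp add: field_simps power2_eq_square)
    qed
    finally show "(\<Sum>k<n. L k x * indicator X x) / real n - indicator X x
        \<le> \<delta> / 2 + (D x)\<^sup>2 / (2 * \<delta>)" .
  qed
  also have "\<dots> = \<delta> / 2 + (\<integral>x. (D x)\<^sup>2 \<partial>P) / (2 * \<delta>)"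
    using D2_int by (simp add: PP.prob_space)
  also have "\<dots> \<le> \<delta> / 2 + (\<delta>\<^sup>2) / (2 * \<delta>)"
  proof -
    have "exp A / real n \<le> \<delta>\<^sup>2"
      using \<delta> n by (simp add: field_simps)
    with D2 \<delta> show ?thesis
      by (intro add_left_mono divide_right_mono) auto
  qed
  also have "\<dots> = \<delta>"
    using \<delta> by (simp add: power2_eq_square)
  finally show ?thesis
    by (simp add: P_def)
qed

section \<open>The law of the white noise data\<close>

text \<open>The sets that members of \<open>\<A>\<close> approximate arbitrarily well are closed
  under complement, since complementing both sets keeps their symmetric difference, and under
  countable unions, by continuity from below and finite subadditivity. So they exhaust the generated
  sigma-algebra.\<close>

lemma (in finite_measure) algebra_approx:
  assumes "algebra \<Omega> \<A>" and sets: "sets M = sigma_sets \<Omega> \<A>"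
    and "E \<in> sets M" "e > 0"
  shows "\<exists>A\<in>\<A>. measure M (sym_diff E A) < e"
proof -
  interpret algebra \<Omega> \<A> by fact
  have \<Omega>: "space M = \<Omega>"
    using sets by (metis sets.sets_into_space sets.top sigma_sets_into_sp sigma_sets_top
        space_closed subset_antisym)
  have in_sets: "A \<in> sets M" if "A \<in> \<A>" for A
    using that by (simp add: sets sigma_sets.Basic)
  define approx where "approx E \<longleftrightarrow> E \<in> sets M \<and>
    (\<forall>e>0. \<exists>A\<in>\<A>. measure M (sym_diff E A) < e)" for E
  have approx_Un: "approx (E \<union> F)" if EF: "approx E" "approx F" for E F
    unfolding approx_def
  proof (intro conjI allI impI)
    show "E \<union> F \<in> sets M"
      using that by (auto simp: approx_def)
    fix e :: real assume "e > 0"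
    then have "e / 2 > 0"
      by simp
    then obtain A B where AB: "A \<in> \<A>" "B \<in> \<A>"
      "measure M (sym_diff E A) < e / 2" "measure M (sym_diff F B) < e / 2"
      using EF unfolding approx_def by meson
    have "E \<in> sets M" "F \<in> sets M" "A \<in> sets M" "B \<in> sets M"
      using AB EF by (auto simp: approx_def in_sets)
    then have "measure M (sym_diff (E \<union> F) (A \<union> B)) \<le> measure M (sym_diff E A \<union> sym_diff F B)"
      by (intro finite_measure_mono) auto
    also have "\<dots> \<le> measure M (sym_diff E A) + measure M (sym_diff F B)"
      using \<open>E \<in> sets M\<close> \<open>F \<in> sets M\<close> \<open>A \<in> sets M\<close> \<open>B \<in> sets M\<close>
      by (intro measure_Un_le) auto
    finally show "\<exists>A\<in>\<A>. measure M (sym_diff (E \<union> F) A) < e"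
      using AB by (intro bexI[of _ "A \<union> B"]) auto
  qed
  have "approx E"
    using \<open>E \<in> sets M\<close> unfolding sets
  proof (induction rule: sigma_sets.induct)
    case (Basic A)
    then show ?case
      by (auto simp: approx_def in_sets intro!: bexI[of _ A])
  next
    case Empty
    then show ?case
      by (auto simp: approx_def intro!: bexI[of _ "{}"])
  next
    case (Compl E)
    have "sym_diff (\<Omega> - E) (\<Omega> - A) = sym_diff E A" if "A \<in> \<A>" for A
    proof -
      have "E \<subseteq> \<Omega>" "A \<subseteq> \<Omega>"
        using Compl.IH that sets.sets_into_space[of _ M] in_sets[OF that]
        by (auto simp: approx_def \<Omega>)
      then show ?thesis by blast
    qed
    then show ?case
      using Compl.IH unfolding approx_def
      by (metis \<Omega> compl_sets sets.compl_sets)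
  next
    case (Union E)
    have fin: "approx (\<Union>i<n. E i)" for n
    proof (induction n)
      case 0
      then show ?case
        by (auto simp: approx_def intro!: bexI[of _ "{}"])
    next
      case (Suc n)
      then show ?case
        using approx_Un[OF Suc Union.IH[of n]] by (simp add: lessThan_Suc Un_commute)
    qed
    have E_sets: "E i \<in> sets M" for i
      using Union.IH by (simp add: approx_def)
    show ?case
      unfolding approx_def
    proof (intro conjI allI impI)
      show "(\<Union>i. E i) \<in> sets M"
        using E_sets by auto
      fix e :: real assume "e > 0"
      have "(\<lambda>n. measure M (\<Union>i<n. E i)) \<longlonglongrightarrow> measure M (\<Union>n. \<Union>i<n. E i)"
        using E_sets by (intro finite_Lim_measure_incseq incseq_SucI) (auto simp: less_Suc_eq)
      moreover have "(\<Union>n. \<Union>i<n. E i) = (\<Union>i. E i)"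
        by auto
      ultimately have "(\<lambda>n. measure M (\<Union>i<n. E i)) \<longlonglongrightarrow> measure M (\<Union>i. E i)"
        by simp
      from LIMSEQ_D[OF this, of "e / 2"] \<open>e > 0\<close> obtain n
        where n: "\<bar>measure M (\<Union>i<n. E i) - measure M (\<Union>i. E i)\<bar> < e / 2"
        by auto
      obtain A where A: "A \<in> \<A>" "measure M (sym_diff (\<Union>i<n. E i) A) < e / 2"
        using fin[of n] \<open>e > 0\<close> unfolding approx_def by (meson half_gt_zero)
      have [measurable]: "A \<in> sets M" "\<And>i. E i \<in> sets M"
        using A E_sets by (auto simp: in_sets)
      have "measure M (sym_diff (\<Union>i. E i) A)
          \<le> measure M (((\<Union>i. E i) - (\<Union>i<n. E i)) \<union> sym_diff (\<Union>i<n. E i) A)"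
        by (intro finite_measure_mono) (blast, measurable)
      also have "\<dots> \<le> measure M ((\<Union>i. E i) - (\<Union>i<n. E i)) + measure M (sym_diff (\<Union>i<n. E i) A)"
        by (intro measure_Un_le) measurable
      also have "measure M ((\<Union>i. E i) - (\<Union>i<n. E i))
          = measure M (\<Union>i. E i) - measure M (\<Union>i<n. E i)"
        using E_sets by (intro finite_measure_Diff) auto
      finally show "\<exists>A\<in>\<A>. measure M (sym_diff (\<Union>i. E i) A) < e"
        using A n by (intro bexI[of _ A]) linarith+
    qed
  qed
  then show ?thesis
    using \<open>e > 0\<close> by (simp add: approx_def)
qed

text \<open>An antiderivative turns the drift of the data into \<open>F t - F 0\<close>, one formula
  for both signs of \<open>t\<close>, and drift increments into differences to which the mean value
  theorem applies.\<close>

lemma antiderivative_exists: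
  fixes f :: "real \<Rightarrow> real"
  assumes "continuous_on UNIV f"
  obtains F where "\<And>x. (F has_real_derivative f x) (at x)"
proof -
  have "\<exists>F. \<forall>x::real. -\<infinity> < ereal x \<longrightarrow> ereal x < \<infinity> \<longrightarrow> (F has_vector_derivative f x) (at x)"
    using assms by (intro einterval_antiderivative)
      (auto simp: continuous_on_eq_continuous_at)
  then show ?thesis
    using that by (auto simp: has_real_derivative_iff_has_vector_derivative)
qed

lemma wn_data_eq:
  assumes "\<And>x. (F has_real_derivative f x) (at x)" "continuous_on UNIV f" "t \<in> {-\<eta>..1 + \<eta>}"
  shows "wn_data W \<eta> s f \<omega> t = F t - F 0 + s * W t \<omega>"
proof -
  have "(LBINT u=ereal 0..ereal t. f u) = F t - F 0"
  proof (rule interval_integral_FTC_finite)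
    show "continuous_on {min 0 t..max 0 t} f"
      using assms(2) by (rule continuous_on_subset) simp
    show "(F has_vector_derivative f x) (at x within {min 0 t..max 0 t})" for x
      using assms(1)[of x]
      by (simp add: has_real_derivative_iff_has_vector_derivative has_vector_derivative_at_within)
  qed
  then show ?thesis
    using assms by (simp add: wn_data_def)
qed

lemma measurable_wn_data:
  assumes bm: "two_sided_brownian_motion M W" and f: "continuous_on UNIV f"
  shows "wn_data W \<eta> s f \<in> measurable M (path_space \<eta>)"
proof -
  obtain F where F: "\<And>x. (F has_real_derivative f x) (at x)"
    using antiderivative_exists[OF f] by blast
  have [measurable]: "W t \<in> borel_measurable M" for t
    using bm by (simp add: two_sided_brownian_motion_def)
  have eq: "wn_data W \<eta> s f = (\<lambda>\<omega>. \<lambda>t\<in>{-\<eta>..1 + \<eta>}. F t - F 0 + s * W t \<omega>)"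
    using wn_data_eq[OF F f] by (auto simp: fun_eq_iff restrict_def wn_data_def)
  have "continuous_on {-\<eta>..1 + \<eta>} (wn_data W \<eta> s f \<omega>)" if "\<omega> \<in> space M" for \<omega>
  proof -
    have "continuous_on {-\<eta>..1 + \<eta>} (\<lambda>t. W t \<omega>)"
      using bm that unfolding two_sided_brownian_motion_def
      by (meson continuous_on_subset subset_UNIV)
    moreover have "continuous_on {-\<eta>..1 + \<eta>} F"
      using F by (meson DERIV_continuous continuous_at_imp_continuous_on)
    ultimately have "continuous_on {-\<eta>..1 + \<eta>} (\<lambda>t. F t - F 0 + s * W t \<omega>)"
      by (intro continuous_intros)
    then show ?thesis
      by (rule continuous_on_eq) (simp add: eq)
  qed
  then show ?thesis
    unfolding path_space_def
    by (intro measurable_restrict_space2) (auto simp: eq)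
qed

text \<open>Increments, unlike values, have a product law, and a change of drift only moves its
  means; this brings the data into the scope of \<open>gauss_shift_mixture\<close>.\<close>

lemma brownian_grid_law:
  assumes bm: "two_sided_brownian_motion M W" and s: "s > 0" and t: "mono t" "m > 0"
    and strict: "\<And>i. i < m \<Longrightarrow> t i < t (Suc i)"
  shows "distr M (\<Pi>\<^sub>M i\<in>{..<m}. borel)
           (\<lambda>\<omega>. \<lambda>i\<in>{..<m}. c i + s * (W (t (Suc i)) \<omega> - W (t i) \<omega>))
         = (\<Pi>\<^sub>M i\<in>{..<m}. gauss (c i) (s * sqrt (t (Suc i) - t i)))"
proof -
  interpret prob_space M
    using bm by (simp add: two_sided_brownian_motion_def)
  let ?X = "\<lambda>i \<omega>. W (t (Suc i)) \<omega> - W (t i) \<omega>"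
  have W [measurable]: "W u \<in> borel_measurable M" for u
    using bm by (simp add: two_sided_brownian_motion_def)
  have indep: "indep_vars (\<lambda>_. borel) ?X {..<m}"
    using bm t by (simp add: two_sided_brownian_motion_def)
  have "indep_vars (\<lambda>_. borel) (\<lambda>i \<omega>. c i + s * ?X i \<omega>) {..<m}"
    by (rule indep_vars_compose2[OF indep]) auto
  then have "distr M (\<Pi>\<^sub>M i\<in>{..<m}. borel) (\<lambda>\<omega>. \<lambda>i\<in>{..<m}. c i + s * ?X i \<omega>)
      = (\<Pi>\<^sub>M i\<in>{..<m}. distr M borel (\<lambda>\<omega>. c i + s * ?X i \<omega>))"
    using t by (subst (asm) indep_vars_iff_distr_eq_PiM') auto
  also have "\<dots> = (\<Pi>\<^sub>M i\<in>{..<m}. gauss (c i) (s * sqrt (t (Suc i) - t i)))"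
  proof (intro PiM_cong refl)
    fix i assume "i \<in> {..<m}"
    then have "t i < t (Suc i)"
      using strict by simp
    then have "distributed M lborel (?X i) (normal_density 0 (sqrt (t (Suc i) - t i)))"
      using bm by (simp add: two_sided_brownian_motion_def)
    then have "distributed M lborel (\<lambda>\<omega>. c i + s * ?X i \<omega>)
        (normal_density (c i + s * 0) (\<bar>s\<bar> * sqrt (t (Suc i) - t i)))"
      using s \<open>t i < t (Suc i)\<close> by (intro normal_density_affine) auto
    then have "distr M lborel (\<lambda>\<omega>. c i + s * ?X i \<omega>) = gauss (c i) (s * sqrt (t (Suc i) - t i))"
      using s by (simp add: distributed_def gauss_def)
    moreover have "distr M lborel (\<lambda>\<omega>. c i + s * ?X i \<omega>) = distr M borel (\<lambda>\<omega>. c i + s * ?X i \<omega>)"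
      by (intro distr_cong) auto
    ultimately show "distr M borel (\<lambda>\<omega>. c i + s * ?X i \<omega>) = gauss (c i) (s * sqrt (t (Suc i) - t i))"
      by simp
  qed
  finally show ?thesis .
qed

section \<open>Finite grids and the increments of a bump\<close>

lemma finite_set_grid:
  fixes S :: "real set"
  assumes "finite S" "card S = Suc m"
  obtains t :: "nat \<Rightarrow> real" where "mono t" "\<And>i j. i < j \<Longrightarrow> j \<le> m \<Longrightarrow> t i < t j" "t ` {..m} = S"
proof
  \<comment> \<open>The sequence is frozen at the largest point from index \<open>m\<close> on,
    because the definition of Brownian motion speaks of sequences that are monotone on all of
    \<open>nat\<close>.\<close>
  define t where "t i = sorted_list_of_set S ! min i m" for i
  have len: "length (sorted_list_of_set S) = Suc m"
    using assms by simp
  show "mono t"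
    unfolding t_def using len by (auto intro!: monoI sorted_nth_mono)
  show "t i < t j" if "i < j" "j \<le> m" for i j
    unfolding t_def using that len strict_sorted_list_of_set[of S]
    by (auto intro!: sorted_wrt_nth_less[of "(<)" "sorted_list_of_set S"])
  have "t ` {..m} = (!) (sorted_list_of_set S) ` {..<Suc m}"
    unfolding t_def by (intro image_cong) auto
  also have "\<dots> = S"
    using assms len by (metis nth_image take_all_iff order_refl set_sorted_list_of_set lessThan_atLeast0)
  finally show "t ` {..m} = S" .
qed

text \<open>Recovers a path at a grid time from its increments. The condition
  \<open>t i < t p\<close> in place of \<open>i < p\<close> lets the same sum be formed for a real
  time whose index is not known.\<close>

lemma sum_increments_upto:
  fixes y t :: "nat \<Rightarrow> real"
  assumes t: "\<And>i j. i < j \<Longrightarrow> j \<le> m \<Longrightarrow> t i < t j" and "p \<le> m"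
  shows "(\<Sum>i<m. if t i < t p then y (Suc i) - y i else 0) = y p - y 0"
proof -
  have "t i < t p \<longleftrightarrow> i < p" if "i < m" for i
    using t[of i p] t[of p i] that \<open>p \<le> m\<close> by (metis less_imp_le_nat linorder_neqE_nat less_asym)
  then have "(\<Sum>i<m. if t i < t p then y (Suc i) - y i else 0)
      = (\<Sum>i<m. if i < p then y (Suc i) - y i else 0)"
    by (intro sum.cong) auto
  also have "\<dots> = (\<Sum>i<p. y (Suc i) - y i)"
    using \<open>p \<le> m\<close> by (intro sum.mono_neutral_cong_right) auto
  also have "\<dots> = y p - y 0"
    by (rule sum_lessThan_telescope)
  finally show ?thesis .
qed

text \<open>The mean value theorem gives a point \<open>z\<close> of the cell with slope
  \<open>g z\<close>. If \<open>z\<close> lies in \<open>{a..b}\<close>, the whole cell does,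
  because neither endpoint is interior to it; otherwise \<open>g z = 0\<close>.\<close>

lemma bump_increment:
  fixes G g :: "real \<Rightarrow> real"
  assumes G: "\<And>x. (G has_real_derivative g x) (at x)"
    and g: "\<And>x. \<bar>g x\<bar> \<le> H" "\<And>x. x \<notin> {a..b} \<Longrightarrow> g x = 0"
    and uv: "u < v" "a \<notin> {u<..<v}" "b \<notin> {u<..<v}" and "a < b"
  shows "\<bar>G v - G u\<bar> \<le> H * (v - u)" "G v - G u = 0 \<or> a \<le> u \<and> v \<le> b"
proof -
  obtain z where z: "u < z" "z < v" "G v - G u = (v - u) * g z"
    using MVT2[of u v G g] G uv(1) by auto
  show "\<bar>G v - G u\<bar> \<le> H * (v - u)"
    using g(1)[of z] uv(1) by (simp add: z(3) abs_mult mult.commute mult_left_mono)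
  show "G v - G u = 0 \<or> a \<le> u \<and> v \<le> b"
  proof (cases "z \<in> {a..b}")
    case True
    then show ?thesis
      using z uv by auto
  next
    case False
    then show ?thesis
      using g(2)[of z] z(3) by simp
  qed
qed

text \<open>The discrete form of bounding the integral of the squared bump over
  \<open>s\<^sup>2\<close>: a cell inside \<open>{a..b}\<close> contributes at most
  \<open>H\<^sup>2 / s\<^sup>2\<close> times its length, any other cell nothing.\<close>

lemma bump_increments_energy:
  fixes G g :: "real \<Rightarrow> real" and t :: "nat \<Rightarrow> real"
  assumes G: "\<And>x. (G has_real_derivative g x) (at x)"
    and g: "\<And>x. \<bar>g x\<bar> \<le> H" "\<And>x. x \<notin> {a..b} \<Longrightarrow> g x = 0" and "a < b" "b - a \<le> w"
    and t: "\<And>i. i < m \<Longrightarrow> t i < t (Suc i)" "\<And>i. i < m \<Longrightarrow> a \<notin> {t i<..<t (Suc i)}"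
      "\<And>i. i < m \<Longrightarrow> b \<notin> {t i<..<t (Suc i)}"
    and "s > 0"
  shows "(\<Sum>i<m. (G (t (Suc i)) - G (t i))\<^sup>2 / (s * sqrt (t (Suc i) - t i))\<^sup>2) \<le> H\<^sup>2 * w / s\<^sup>2"
proof -
  \<comment> \<open>Clamping to \<open>{a..b}\<close> measures the part of a cell inside the bump
    and makes these lengths telescope.\<close>
  define c where "c x = max a (min b x)" for x
  have "(\<Sum>i<m. (G (t (Suc i)) - G (t i))\<^sup>2 / (s * sqrt (t (Suc i) - t i))\<^sup>2)
      \<le> (\<Sum>i<m. H\<^sup>2 / s\<^sup>2 * (c (t (Suc i)) - c (t i)))"
  proof (intro sum_mono)
    fix i assume "i \<in> {..<m}"
    then have i: "t i < t (Suc i)" "a \<notin> {t i<..<t (Suc i)}" "b \<notin> {t i<..<t (Suc i)}"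
      using t by auto
    let ?d = "G (t (Suc i)) - G (t i)" and ?l = "t (Suc i) - t i"
    have le: "\<bar>?d\<bar> \<le> H * ?l" and or: "?d = 0 \<or> a \<le> t i \<and> t (Suc i) \<le> b"
      using bump_increment[OF G g i \<open>a < b\<close>] by blast+
    have mono: "c (t i) \<le> c (t (Suc i))"
      using i(1) by (auto simp: c_def)
    show "?d\<^sup>2 / (s * sqrt ?l)\<^sup>2 \<le> H\<^sup>2 / s\<^sup>2 * (c (t (Suc i)) - c (t i))"
    proof (cases "?d = 0")
      case True
      then show ?thesis
        using mono by simp
    next
      case False
      then have "c (t (Suc i)) - c (t i) = ?l"
        using or i(1) by (auto simp: c_def)
      moreover have "?d\<^sup>2 \<le> (H * ?l)\<^sup>2"
        using le by (intro power2_le_iff_abs_le[THEN iffD2]) auto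
      then have "?d\<^sup>2 / (s\<^sup>2 * ?l) \<le> (H * ?l)\<^sup>2 / (s\<^sup>2 * ?l)"
        using i(1) by (intro divide_right_mono) auto
      moreover have "(H * ?l)\<^sup>2 / (s\<^sup>2 * ?l) = H\<^sup>2 / s\<^sup>2 * ?l"
        using i(1) by (simp add: power_mult_distrib power2_eq_square)
      ultimately show ?thesis
        using i(1) by (simp add: power_mult_distrib)
    qed
  qed
  also have "\<dots> = H\<^sup>2 / s\<^sup>2 * (c (t m) - c (t 0))"
    by (subst sum_lessThan_telescope[symmetric]) (simp add: sum_distrib_left)
  also have "\<dots> \<le> H\<^sup>2 / s\<^sup>2 * w"
    using \<open>a < b\<close> \<open>b - a \<le> w\<close> by (intro mult_left_mono) (auto simp: c_def)
  finally show ?thesis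
    by simp
qed

text \<open>The data at the times in \<open>J\<close> are functions of the increments over a finite
  grid that also contains the bump endpoints. On this grid no cell is shifted by two bumps, so
  \<open>gauss_shift_mixture\<close> applies. The bound is uniform in \<open>J\<close>, as the
  extension to general events requires.\<close>

lemma cylinder_mixture:
  fixes F :: "real \<Rightarrow> real" and G g :: "nat \<Rightarrow> real \<Rightarrow> real" and a b :: "nat \<Rightarrow> real"
  assumes bm: "two_sided_brownian_motion M W" and s: "s > 0" and n: "n > 0"
    and G: "\<And>k x. (G k has_real_derivative g k x) (at x)"
    and g: "\<And>k x. \<bar>g k x\<bar> \<le> H" "\<And>k x. x \<notin> {a k..b k} \<Longrightarrow> g k x = 0"
    and ab: "\<And>k. a k < b k" "\<And>k. b k - a k \<le> w"
    and disj: "\<And>k l. k < n \<Longrightarrow> l < n \<Longrightarrow> k \<noteq> l \<Longrightarrow> {a k<..<b k} \<inter> {a l<..<b l} = {}"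
    and \<delta>: "\<delta> > 0" "exp (H\<^sup>2 * w / s\<^sup>2) \<le> real n * \<delta>\<^sup>2"
    and J: "finite J" and X: "X \<in> sets (\<Pi>\<^sub>M t\<in>J. borel)"
  shows "(\<Sum>k<n. measure M {\<omega>\<in>space M.
             (\<lambda>t\<in>J. F t + G k t - (F 0 + G k 0) + s * W t \<omega>) \<in> X}) / real n
           \<le> measure M {\<omega>\<in>space M. (\<lambda>t\<in>J. F t - F 0 + s * W t \<omega>) \<in> X} + \<delta>"
proof -
  \<comment> \<open>0 is the time at which the path is pinned, 1 guarantees a second point and hence
    at least one cell, and the endpoints prevent a bump from starting or ending inside a
    cell.\<close>
  define S where "S = insert 0 (insert 1 J) \<union> a ` {..<n} \<union> b ` {..<n}"
  have "finite S"
    unfolding S_def using J by simp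
  moreover have "card {0, 1::real} \<le> card S"
    using \<open>finite S\<close> by (rule card_mono) (simp add: S_def)
  ultimately obtain m where m: "card S = Suc m" "m > 0"
    by (cases "card S") auto
  obtain t where t: "mono t" "\<And>i j. i < j \<Longrightarrow> j \<le> m \<Longrightarrow> t i < t j" "t ` {..m} = S"
    using finite_set_grid[OF \<open>finite S\<close> m(1)] by blast
  have cell: "e \<notin> {t i<..<t (Suc i)}" if eS: "e \<in> S" "i < m" for e i
  proof
    assume e: "e \<in> {t i<..<t (Suc i)}"
    obtain p where "p \<le> m" "e = t p"
      using eS t(3) by blast
    then show False
      using e monoD[OF t(1), of p i] monoD[OF t(1), of "Suc i" p] by (cases "p \<le> i") auto
  qed
  \<comment> \<open>The value 1 beyond the grid keeps \<open>v i\<close> positive for every index,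
    as \<open>gauss_shift_mixture\<close> demands.\<close>
  define v where "v i = (if i < m then s * sqrt (t (Suc i) - t i) else 1)" for i
  \<comment> \<open>The grid may begin to the left of 0. Each sum measures from its first point, so
    subtracting the sum for time 0 restores the normalisation of the data.\<close>
  define \<Phi> where "\<Phi> d = (\<lambda>u\<in>J. (\<Sum>i<m. if t i < u then d i else 0)
      - (\<Sum>i<m. if t i < 0 then d i else 0))" for d :: "nat \<Rightarrow> real"
  define Y where "Y = \<Phi> -` X \<inter> space (\<Pi>\<^sub>M i\<in>{..<m}. (borel :: real measure))"
  have \<Phi> [measurable]: "\<Phi> \<in> measurable (\<Pi>\<^sub>M i\<in>{..<m}. borel) (\<Pi>\<^sub>M t\<in>J. borel)"
    unfolding \<Phi>_def by measurable
  then have Y: "Y \<in> sets (\<Pi>\<^sub>M i\<in>{..<m}. borel)"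
    unfolding Y_def using X by (rule measurable_sets)
  have W [measurable]: "W u \<in> borel_measurable M" for u
    using bm by (simp add: two_sided_brownian_motion_def)
  have step: "t i < t (Suc i)" if "i < m" for i
    using t(2)[of i "Suc i"] that by simp
  have law: "measure M {\<omega>\<in>space M. (\<lambda>u\<in>J. A u - A 0 + s * W u \<omega>) \<in> X}
      = measure (\<Pi>\<^sub>M i\<in>{..<m}. gauss (A (t (Suc i)) - A (t i)) (v i)) Y" for A
  proof -
    let ?D = "\<lambda>\<omega>. \<lambda>i\<in>{..<m}. A (t (Suc i)) - A (t i) + s * (W (t (Suc i)) \<omega> - W (t i) \<omega>)"
    have D: "?D \<in> measurable M (\<Pi>\<^sub>M i\<in>{..<m}. borel)"
      by measurable
    have "\<Phi> (?D \<omega>) = (\<lambda>u\<in>J. A u - A 0 + s * W u \<omega>)" if "\<omega> \<in> space M" for \<omega>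
    proof -
      define y where "y i = A (t i) + s * W (t i) \<omega>" for i
      have sum: "(\<Sum>i<m. if t i < u then ?D \<omega> i else 0) = A u + s * W u \<omega> - y 0"
        if uS: "u \<in> S" for u
      proof -
        obtain p where p: "p \<le> m" "u = t p"
          using uS t(3) by blast
        have "(\<Sum>i<m. if t i < u then ?D \<omega> i else 0)
            = (\<Sum>i<m. if t i < t p then y (Suc i) - y i else 0)"
          by (intro sum.cong) (auto simp: p y_def algebra_simps)
        also have "\<dots> = y p - y 0"
          using t(2) p(1) by (rule sum_increments_upto)
        finally show ?thesis
          by (simp add: y_def p)
      qed
      have "W 0 \<omega> = 0"
        using bm that by (simp add: two_sided_brownian_motion_def)
      then show ?thesis
        unfolding \<Phi>_def using sum[of 0] sum by (auto simp: S_def fun_eq_iff)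
    qed
    then have "{\<omega>\<in>space M. (\<lambda>u\<in>J. A u - A 0 + s * W u \<omega>) \<in> X} = ?D -` Y \<inter> space M"
      using measurable_space[OF D] by (auto simp: Y_def)
    also have "measure M \<dots> = measure (distr M (\<Pi>\<^sub>M i\<in>{..<m}. borel) ?D) Y"
      using D Y by (simp add: measure_distr)
    also have "distr M (\<Pi>\<^sub>M i\<in>{..<m}. borel) ?D
        = (\<Pi>\<^sub>M i\<in>{..<m}. gauss (A (t (Suc i)) - A (t i)) (v i))"
      unfolding v_def
      by (subst brownian_grid_law[OF bm s t(1) m(2) step]) (auto intro!: PiM_cong)
    finally show ?thesis .
  qed
  define \<mu> where "\<mu> i = F (t (Suc i)) - F (t i)" for i
  define d where "d k i = G k (t (Suc i)) - G k (t i)" for k i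
  have law0: "measure M {\<omega>\<in>space M. (\<lambda>u\<in>J. F u - F 0 + s * W u \<omega>) \<in> X}
      = measure (\<Pi>\<^sub>M i\<in>{..<m}. gauss (\<mu> i) (v i)) Y"
    unfolding \<mu>_def by (rule law)
  have lawk: "measure M {\<omega>\<in>space M. (\<lambda>u\<in>J. F u + G k u - (F 0 + G k 0) + s * W u \<omega>) \<in> X}
      = measure (\<Pi>\<^sub>M i\<in>{..<m}. gauss (\<mu> i + d k i) (v i)) Y" for k
    unfolding \<mu>_def d_def using law[of "\<lambda>u. F u + G k u"] by (simp add: algebra_simps)
  show ?thesis
    unfolding law0 lawk
  proof (rule gauss_shift_mixture)
    show "v i > 0" for i
      using step s by (simp add: v_def)
    \<comment> \<open>If both increments were nonzero, the cell would lie inside both bump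
      intervals, whose interiors are disjoint.\<close>
    show "d k i * d l i = 0" if "k < n" "l < n" "k \<noteq> l" "i \<in> {..<m}" for k l i
    proof (rule ccontr)
      assume "d k i * d l i \<noteq> 0"
      moreover have "d j i = 0 \<or> a j \<le> t i \<and> t (Suc i) \<le> b j" if "j < n" for j
        unfolding d_def using \<open>i \<in> {..<m}\<close> that
        by (intro bump_increment(2)[where g = "g j" and a = "a j" and b = "b j" and H = H]
            G g step cell ab) (auto simp: S_def)
      ultimately have "{t i<..<t (Suc i)} \<subseteq> {a k<..<b k} \<inter> {a l<..<b l}"
        using that by fastforce
      moreover have "t i < t (Suc i)"
        using \<open>i \<in> {..<m}\<close> step by simp
      ultimately show False
        using disj[OF that(1-3)] by (metis dense empty_iff greaterThanLessThan_iff subsetD)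
    qed
    show "(\<Sum>i<m. (d k i)\<^sup>2 / (v i)\<^sup>2) \<le> H\<^sup>2 * w / s\<^sup>2" if "k < n" for k
    proof -
      have "(\<Sum>i<m. (d k i)\<^sup>2 / (v i)\<^sup>2)
          = (\<Sum>i<m. (G k (t (Suc i)) - G k (t i))\<^sup>2 / (s * sqrt (t (Suc i) - t i))\<^sup>2)"
        by (intro sum.cong) (auto simp: d_def v_def)
      also have "\<dots> \<le> H\<^sup>2 * w / s\<^sup>2"
        using that
        by (intro bump_increments_energy[where g = "g k" and a = "a k" and b = "b k"]
            G g ab step cell s) (auto simp: S_def)
      finally show ?thesis .
    qed
  qed (use n \<delta> Y in auto)
qed

text \<open>Passing from cylinder events to arbitrary events of the path space, so that no
  Cameron--Martin density on the path space is needed.\<close>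
lemma white_noise_mixture:
  fixes f :: "real \<Rightarrow> real" and g :: "nat \<Rightarrow> real \<Rightarrow> real" and a b :: "nat \<Rightarrow> real"
  assumes bm: "two_sided_brownian_motion M W" and s: "s > 0" and n: "n > 0"
    and f: "continuous_on UNIV f" and g_cont: "\<And>k. continuous_on UNIV (g k)"
    and g: "\<And>k x. \<bar>g k x\<bar> \<le> H" "\<And>k x. x \<notin> {a k..b k} \<Longrightarrow> g k x = 0"
    and ab: "\<And>k. a k < b k" "\<And>k. b k - a k \<le> w"
    and disj: "\<And>k l. k < n \<Longrightarrow> l < n \<Longrightarrow> k \<noteq> l \<Longrightarrow> {a k<..<b k} \<inter> {a l<..<b l} = {}"
    and \<delta>: "\<delta> > 0" "exp (H\<^sup>2 * w / s\<^sup>2) \<le> real n * \<delta>\<^sup>2"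
    and E: "E \<in> sets (path_space \<eta>)"
  shows "(\<Sum>k<n. measure (distr M (path_space \<eta>) (wn_data W \<eta> s (\<lambda>x. f x + g k x))) E) / real n
           \<le> measure (distr M (path_space \<eta>) (wn_data W \<eta> s f)) E + \<delta>"
proof -
  interpret prob_space M
    using bm by (simp add: two_sided_brownian_motion_def)
  let ?T = "{-\<eta>..1 + \<eta>}"
  let ?Q = "\<Pi>\<^sub>M t\<in>?T. (borel :: real measure)"
  obtain F where F: "\<And>x. (F has_real_derivative f x) (at x)"
    using antiderivative_exists[OF f] by blast
  have "\<exists>G. \<forall>x. (G has_real_derivative g k x) (at x)" for k
    using antiderivative_exists[OF g_cont[of k]] by blast
  then obtain G where G: "\<And>k x. (G k has_real_derivative g k x) (at x)"
    by metis
  define y where "y k = (case k of None \<Rightarrow> wn_data W \<eta> s f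
      | Some k \<Rightarrow> wn_data W \<eta> s (\<lambda>x. f x + g k x))" for k
  have fg: "continuous_on UNIV (\<lambda>x. f x + g k x)" for k
    using f g_cont by (intro continuous_intros)
  have y_path: "y k \<in> measurable M (path_space \<eta>)" for k
    unfolding y_def using measurable_wn_data[OF bm f] measurable_wn_data[OF bm fg]
    by (auto split: option.split)
  have y_Q [measurable]: "y k \<in> measurable M ?Q" for k
    using y_path[of k] unfolding path_space_def by (rule measurable_restrict_space2_iff[THEN iffD1, THEN conjunct1])
  have y_None: "y None \<omega> t = F t - F 0 + s * W t \<omega>" if "t \<in> ?T" for \<omega> t
    unfolding y_def using wn_data_eq[OF F f that] by simp
  have y_Some: "y (Some k) \<omega> t = F t + G k t - (F 0 + G k 0) + s * W t \<omega>"
    if "t \<in> ?T" for k \<omega> t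
    unfolding y_def
    using wn_data_eq[of "\<lambda>t. F t + G k t" "\<lambda>x. f x + g k x", OF DERIV_add[OF F G] fg that]
    by simp
  define p where "p k A = measure M (y k -` A \<inter> space M)" for k A
  \<comment> \<open>\<open>E'\<close> is an event of the product sigma-algebra with trace
    \<open>E\<close> on the continuous paths. All data paths are continuous, so both have the same
    preimage.\<close>
  obtain E' where E': "E' \<in> sets ?Q" "E = {y. continuous_on ?T y} \<inter> E'"
    using E unfolding path_space_def sets_restrict_space by auto
  have p: "measure (distr M (path_space \<eta>) (y k)) E = p k E'" for k
  proof -
    have "y k -` E \<inter> space M = y k -` E' \<inter> space M"
      using measurable_space[OF y_path[of k]] by (auto simp: E' path_space_def space_restrict_space)
    then show ?thesis
      using y_path[of k] E by (simp add: measure_distr p_def)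
  qed
  \<comment> \<open>The finite-dimensional laws of the unperturbed data form a projective family;
    what it supplies is the algebra of cylinders that generates the product sigma-algebra.\<close>
  interpret proj: projective_family ?T "\<lambda>J. distr M (\<Pi>\<^sub>M t\<in>J. borel) (\<lambda>\<omega>. restrict (y None \<omega>) J)"
    "\<lambda>_. borel"
  proof (unfold projective_family_def, intro conjI allI impI)
    have meas: "(\<lambda>\<omega>. restrict (y None \<omega>) J) \<in> measurable M (\<Pi>\<^sub>M t\<in>J. borel)" if "J \<subseteq> ?T" for J
      using measurable_compose[OF y_Q measurable_restrict_subset[OF that]] by simp
    show "prob_space (distr M (\<Pi>\<^sub>M t\<in>J. borel) (\<lambda>\<omega>. restrict (y None \<omega>) J))"
      if "finite J" "J \<subseteq> ?T" for J
      using meas[OF that(2)] by (rule prob_space_distr)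
    show "distr M (\<Pi>\<^sub>M t\<in>J. borel) (\<lambda>\<omega>. restrict (y None \<omega>) J)
        = distr (distr M (\<Pi>\<^sub>M t\<in>H. borel) (\<lambda>\<omega>. restrict (y None \<omega>) H)) (\<Pi>\<^sub>M t\<in>J. borel)
            (\<lambda>f. restrict f J)" if "J \<subseteq> H" "finite H" "H \<subseteq> ?T" for J H
      using meas[OF that(3)] measurable_restrict_subset[OF that(1)] that(1)
      by (subst distr_distr) (auto simp: comp_def Int_absorb1)
  qed
  have cyl: "(\<Sum>k<n. p (Some k) A) / real n \<le> p None A + \<delta>" if "A \<in> proj.generator" for A
    using that
  proof (cases rule: proj.generator.cases)
    case (1 J X)
    have "y k -` A \<inter> space M = {\<omega>\<in>space M. restrict (y k \<omega>) J \<in> X}" for k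
      using measurable_space[OF y_Q[of k]] 1 by (auto simp: prod_emb_def space_PiM)
    moreover have "restrict (y (Some k) \<omega>) J
        = (\<lambda>t\<in>J. F t + G k t - (F 0 + G k 0) + s * W t \<omega>)" for k \<omega>
      using 1 y_Some by (auto simp: fun_eq_iff)
    moreover have "restrict (y None \<omega>) J = (\<lambda>t\<in>J. F t - F 0 + s * W t \<omega>)" for \<omega>
      using 1 y_None by (auto simp: fun_eq_iff)
    moreover have "(\<Sum>k<n. measure M {\<omega>\<in>space M.
             (\<lambda>t\<in>J. F t + G k t - (F 0 + G k 0) + s * W t \<omega>) \<in> X}) / real n
           \<le> measure M {\<omega>\<in>space M. (\<lambda>t\<in>J. F t - F 0 + s * W t \<omega>) \<in> X} + \<delta>"
      by (rule cylinder_mixture[where g = g and a = a and b = b and H = H and w = w,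
            OF bm s n G g ab disj \<delta> 1(2) 1(4)])
    ultimately show ?thesis
      by (simp add: p_def)
  qed
  text \<open>Approximate \<open>E'\<close> by a cylinder simultaneously for all the laws involved, by
    approximating with respect to their sum.\<close>
  have approx: "(\<Sum>k<n. p (Some k) E') / real n \<le> p None E' + \<delta> + e" if "e > 0" for e
  proof -
    let ?I = "insert None (Some ` {..<n})"
    let ?C = "count_space ?I \<Otimes>\<^sub>M M"
    let ?y = "\<lambda>(k, \<omega>). y k \<omega>"
    \<comment> \<open>The image of counting measure times \<open>M\<close> gives the sum of the laws
      as one finite measure.\<close>
    define \<nu> where "\<nu> = distr ?C ?Q ?y"
    interpret I: finite_measure "count_space ?I"
      by (rule finite_measure_count_space) simp
    interpret C: finite_measure ?C
      by (intro finite_measure_pair_measure finite_measure_axioms I.finite_measure_axioms)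
    have y_C: "?y \<in> measurable ?C ?Q"
      by (rule measurable_pair_measure_countable1) auto
    interpret \<nu>: finite_measure \<nu>
      unfolding \<nu>_def by (rule C.finite_measure_distr[OF y_C])
    have p_le: "p k B \<le> measure \<nu> B" if "k \<in> ?I" "B \<in> sets ?Q" for k B
    proof -
      have S: "y k -` B \<inter> space M \<in> sets M"
        using y_Q[of k] that(2) by (rule measurable_sets)
      have "p k B = measure ?C ({k} \<times> (y k -` B \<inter> space M))"
        using S that by (simp add: p_def measure_def emeasure_pair_measure_Times)
      also have "\<dots> \<le> measure ?C (?y -` B \<inter> space ?C)"
        using that measurable_sets[OF y_C that(2)]
        by (intro C.finite_measure_mono) (auto simp: space_pair_measure)
      also have "\<dots> = measure \<nu> B"
        using y_C that by (simp add: \<nu>_def measure_distr)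
      finally show ?thesis .
    qed
    have "\<exists>A\<in>proj.generator. measure \<nu> (sym_diff E' A) < e / 2"
      using proj.algebra_generator proj.sets_PiM_generator E'(1) that
      by (intro \<nu>.algebra_approx) (auto simp: \<nu>_def)
    then obtain A where A: "A \<in> proj.generator" "measure \<nu> (sym_diff E' A) < e / 2"
      by blast
    have A_sets: "A \<in> sets ?Q"
      using A(1) by (auto simp: proj.sets_PiM_generator)
    have close: "p k B \<le> p k B' + e / 2" if "k \<in> ?I" "B = A \<and> B' = E' \<or> B = E' \<and> B' = A" for k B B'
    proof -
      have meas: "y k -` D \<inter> space M \<in> sets M" if "D \<in> sets ?Q" for D
        using y_Q[of k] that by (rule measurable_sets)
      have "B \<in> sets ?Q" "B' \<in> sets ?Q" "sym_diff E' A \<in> sets ?Q"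
        using that(2) E'(1) A_sets by auto
      note sets = this[THEN meas]
      have "p k B \<le> measure M ((y k -` B' \<inter> space M) \<union> (y k -` sym_diff E' A \<inter> space M))"
        unfolding p_def using sets that(2) by (intro finite_measure_mono) auto
      also have "\<dots> \<le> p k B' + p k (sym_diff E' A)"
        unfolding p_def using sets by (intro measure_Un_le)
      also have "p k (sym_diff E' A) \<le> e / 2"
        using p_le[OF that(1) \<open>sym_diff E' A \<in> sets ?Q\<close>] A(2) by simp
      finally show ?thesis
        by simp
    qed
    have "(\<Sum>k<n. p (Some k) E') / real n \<le> (\<Sum>k<n. p (Some k) A + e / 2) / real n"
      using close[of "Some _" E' A] by (intro divide_right_mono sum_mono) auto
    also have "\<dots> = (\<Sum>k<n. p (Some k) A) / real n + e / 2"
      using n by (subst sum.distrib) (simp add: add_divide_distrib)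
    finally show ?thesis
      using cyl[OF A(1)] close[of None A E'] by simp
  qed
  have "(\<Sum>k<n. p (Some k) E') / real n \<le> p None E' + \<delta>"
    by (rule field_le_epsilon) (use approx in simp)
  then show ?thesis
    unfolding p[symmetric] by (simp add: y_def)
qed

section \<open>The length of confidence bands\<close>

text \<open>Coverage events are measurable only for the completed laws, while the mixture inequality
  concerns events of \<open>path_space\<close>. An inner approximation loses no probability and,
  being a subset, still implies coverage.\<close>

lemma completion_inner_approx:
  assumes "A \<in> sets (completion N)"
  obtains A' where "A' \<in> sets N" "A' \<subseteq> A" "measure N A' = measure (completion N) A"
proof
  show "main_part N A \<in> sets N" "main_part N A \<subseteq> A"
    using assms main_part_null_part_Un[OF assms] by (simp, blast)
  show "measure N (main_part N A) = measure (completion N) A"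
    using assms by (simp add: measure_def)
qed

lemma max_length_ge:
  assumes "x \<in> {0..1}" "u \<in> C y x" "u + H \<in> C y x"
  shows "ereal H \<le> max_length C y"
proof -
  have "ereal H = ereal (u + H) - ereal u"
    by simp
  also have "\<dots> \<le> set_length (C y x)"
    unfolding set_length_def using assms(2,3)
    by (intro ereal_minus_mono Sup_upper Inf_lower) auto
  also have "\<dots> \<le> max_length C y"
    unfolding max_length_def using assms(1) by (rule SUP_upper)
  finally show ?thesis .
qed

text \<open>Under \<open>f\<close> the band misses \<open>f\<close> with probability at most
  \<open>\<alpha>\<close>, and misses all perturbed functions with probability at most
  \<open>\<alpha> + \<delta>\<close>. Otherwise it contains two values at some \<open>z k\<close>
  that differ by \<open>H\<close>. So bands shorter than \<open>H\<close> have probability below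
  \<open>\<beta>\<close>.\<close>

lemma worst_length_lower_bound:
  fixes f :: "real \<Rightarrow> real" and g :: "nat \<Rightarrow> real \<Rightarrow> real" and a b z :: "nat \<Rightarrow> real"
  assumes bm: "two_sided_brownian_motion M W" and s: "s > 0" and n: "n > 0"
    and f: "continuous_on UNIV f" and g_cont: "\<And>k. continuous_on UNIV (g k)"
    and g: "\<And>k x. \<bar>g k x\<bar> \<le> H" "\<And>k x. x \<notin> {a k..b k} \<Longrightarrow> g k x = 0"
    and ab: "\<And>k. a k < b k" "\<And>k. b k - a k \<le> w"
    and disj: "\<And>k l. k < n \<Longrightarrow> l < n \<Longrightarrow> k \<noteq> l \<Longrightarrow> {a k<..<b k} \<inter> {a l<..<b l} = {}"
    and \<delta>: "\<delta> > 0" "exp (H\<^sup>2 * w / s\<^sup>2) \<le> real n * \<delta>\<^sup>2" "2 * \<alpha> + \<delta> < \<beta>"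
    and z: "\<And>k. k < n \<Longrightarrow> z k \<in> {0..1}" "\<And>k. k < n \<Longrightarrow> g k (z k) = H"
    and F: "f \<in> F" "\<And>k. k < n \<Longrightarrow> (\<lambda>x. f x + g k x) \<in> F" and G: "f \<in> G" "G \<subseteq> F"
    and C: "C \<in> conf_bands M W \<eta> s \<alpha> F"
  shows "ereal H \<le> worst_length M W \<eta> s \<beta> C G"
proof -
  let ?law = "\<lambda>f. distr M (path_space \<eta>) (wn_data W \<eta> s f)"
  define f' where "f' k = (\<lambda>x. f x + g k x)" for k
  have cont: "continuous_on UNIV (f' k)" for k
    unfolding f'_def using f g_cont by (intro continuous_intros)
  have C_cover: "cover_event \<eta> C h \<in> sets (completion (?law h))"
      "1 - \<alpha> \<le> measure (completion (?law h)) (cover_event \<eta> C h)"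
      "max_length C \<in> borel_measurable (completion (?law h))" if "h \<in> F" for h
    using C that by (auto simp: conf_bands_def wn_law_def le_INF_iff)
  interpret M: prob_space M
    using bm by (simp add: two_sided_brownian_motion_def)
  interpret P: prob_space "?law f"
    by (intro M.prob_space_distr measurable_wn_data[OF bm f])
  obtain A where A: "A \<in> sets (?law f)" "A \<subseteq> cover_event \<eta> C f" "1 - \<alpha> \<le> measure (?law f) A"
    using completion_inner_approx[OF C_cover(1)[OF F(1)]] C_cover(2)[OF F(1)] by metis
  have "\<exists>A. A \<in> sets (?law (f' k)) \<and> A \<subseteq> cover_event \<eta> C (f' k) \<and> 1 - \<alpha> \<le> measure (?law (f' k)) A"
    if "k < n" for k
  proof -
    have "f' k \<in> F"
      using F(2)[OF that] by (simp add: f'_def)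
    note C_cover = C_cover[OF this]
    obtain A where "A \<in> sets (?law (f' k))" "A \<subseteq> cover_event \<eta> C (f' k)"
      "measure (?law (f' k)) A = measure (completion (?law (f' k))) (cover_event \<eta> C (f' k))"
      using C_cover(1) by (rule completion_inner_approx)
    then show ?thesis
      using C_cover(2) by auto
  qed
  then obtain A' where A': "\<And>k. k < n \<Longrightarrow> A' k \<in> sets (?law (f' k))"
    "\<And>k. k < n \<Longrightarrow> A' k \<subseteq> cover_event \<eta> C (f' k)" "\<And>k. k < n \<Longrightarrow> 1 - \<alpha> \<le> measure (?law (f' k)) (A' k)"
    by metis
  \<comment> \<open>One event that does not depend on \<open>k\<close>: the mixture inequality
    compares probabilities of a fixed event.\<close>
  define U where "U = (\<Union>k<n. A' k)"
  have U: "U \<in> sets (path_space \<eta>)"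
    unfolding U_def using A'(1) by auto
  have "1 - \<alpha> = (\<Sum>k<n. 1 - \<alpha>) / real n"
    using n by simp
  also have "\<dots> \<le> (\<Sum>k<n. measure (?law (f' k)) U) / real n"
  proof (intro divide_right_mono sum_mono)
    fix k assume "k \<in> {..<n}"
    then have k: "k < n" by simp
    interpret Q: prob_space "?law (f' k)"
      by (intro M.prob_space_distr measurable_wn_data[OF bm cont])
    have "measure (?law (f' k)) (A' k) \<le> measure (?law (f' k)) U"
      using U k by (intro Q.finite_measure_mono) (auto simp: U_def)
    then show "1 - \<alpha> \<le> measure (?law (f' k)) U"
      using A'(3)[OF k] by simp
  qed simp
  also have "\<dots> \<le> measure (?law f) U + \<delta>"
    unfolding f'_def
    by (rule white_noise_mixture[where g = g and a = a and b = b and H = H and w = w,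
          OF bm s n f g_cont g ab disj \<delta>(1,2) U])
  finally have P_U: "1 - \<alpha> - \<delta> \<le> measure (?law f) U"
    by simp
  \<comment> \<open>The quantile is an infimum, so each admissible \<open>q\<close> has to be at
    least \<open>H\<close>. For a smaller one the event of length at most \<open>q\<close> is
    disjoint from joint coverage.\<close>
  have "ereal H \<le> q" if q: "\<beta> \<le> measure (wn_law M W \<eta> s f) {y \<in> space (wn_law M W \<eta> s f). max_length C y \<le> q}" for q
  proof (rule ccontr)
    assume "\<not> ereal H \<le> q"
    let ?S = "{y \<in> space (path_space \<eta>). max_length C y \<le> q}"
    have "?S \<in> sets (completion (?law f))"
      using borel_measurable_le[OF C_cover(3)[OF F(1)], of "\<lambda>_. q"] by simp
    then obtain L where L: "L \<in> sets (?law f)" "L \<subseteq> ?S" "measure (?law f) L = measure (completion (?law f)) ?S"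
      by (rule completion_inner_approx)
    have "A \<inter> U \<inter> L = {}"
    proof (rule ccontr)
      assume "A \<inter> U \<inter> L \<noteq> {}"
      then obtain y k where y: "y \<in> A" "k < n" "y \<in> A' k" "y \<in> L"
        by (auto simp: U_def)
      have "f (z k) \<in> C y (z k)" "f' k (z k) \<in> C y (z k)"
        using A(2) A'(2)[OF y(2)] y z(1)[OF y(2)] by (auto simp: cover_event_def)
      then have "ereal H \<le> max_length C y"
        using z[OF y(2)] by (intro max_length_ge[of "z k" "f (z k)"]) (auto simp: f'_def)
      also have "\<dots> \<le> q"
        using L(2) y(4) by auto
      finally show False
        using \<open>\<not> ereal H \<le> q\<close> by contradiction
    qed
    then have "L \<subseteq> (space (?law f) - A) \<union> (space (?law f) - U)"
      using sets.sets_into_space[OF L(1)] by blast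
    then have "measure (?law f) L \<le> measure (?law f) ((space (?law f) - A) \<union> (space (?law f) - U))"
      using A(1) U by (intro P.finite_measure_mono) auto
    also have "\<dots> \<le> measure (?law f) (space (?law f) - A) + measure (?law f) (space (?law f) - U)"
      using A(1) U by (intro measure_Un_le) auto
    also have "\<dots> = (1 - measure (?law f) A) + (1 - measure (?law f) U)"
      using A(1) U by (simp add: P.prob_compl del: space_distr)
    also have "\<dots> < \<beta>"
      using A(3) P_U \<delta>(3) by simp
    finally show False
      using q L(3) by (simp add: wn_law_def)
  qed
  then have "ereal H \<le> quantile (wn_law M W \<eta> s f) \<beta> (max_length C)"
    unfolding quantile_def by (intro Inf_greatest) auto
  also have "\<dots> \<le> worst_length M W \<eta> s \<beta> C G"
    unfolding worst_length_def using G(1) by (rule SUP_upper)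
  finally show ?thesis .
qed

section \<open>Bump functions\<close>

lemma deriv_iterate:
  assumes "\<And>k x. k < m \<Longrightarrow> (D k has_real_derivative D (Suc k) x) (at x)" "k \<le> m"
  shows "(deriv ^^ k) (D 0) = D k"
  using assms(2)
proof (induction k)
  case (Suc k)
  then show ?case
    using assms(1)[of k] by (auto intro!: ext DERIV_imp_deriv)
qed simp

lemma holder_classI:
  assumes "\<And>k x. k < strict_floor \<gamma> \<Longrightarrow> (D k has_real_derivative D (Suc k) x) (at x)"
    and "\<And>t t'. \<bar>D (strict_floor \<gamma>) t - D (strict_floor \<gamma>) t'\<bar>
           \<le> B * \<bar>t - t'\<bar> powr (\<gamma> - strict_floor \<gamma>)"
  shows "D 0 \<in> holder_class \<gamma> B"
  unfolding holder_class_def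
  using assms by (auto simp: deriv_iterate[of "strict_floor \<gamma>" D] real_differentiable_def)

lemma holder_class_DERIV:
  assumes "f \<in> holder_class \<gamma> B" "k < strict_floor \<gamma>"
  shows "((deriv ^^ k) f has_real_derivative (deriv ^^ Suc k) f x) (at x)"
  using assms by (simp add: holder_class_def DERIV_deriv_iff_real_differentiable)

lemma holder_class_add:
  assumes f: "f \<in> holder_class \<gamma> B" and g: "g \<in> holder_class \<gamma> B'"
  shows "(\<lambda>x. f x + g x) \<in> holder_class \<gamma> (B + B')"
proof -
  let ?m = "strict_floor \<gamma>"
  let ?D = "\<lambda>k x. (deriv ^^ k) f x + (deriv ^^ k) g x"
  have "?D 0 \<in> holder_class \<gamma> (B + B')"
  proof (rule holder_classI)
    show "(?D k has_real_derivative ?D (Suc k) x) (at x)" if "k < ?m" for k x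
      using holder_class_DERIV[OF f that] holder_class_DERIV[OF g that] by (rule DERIV_add)
    fix t t'
    have "\<bar>(deriv ^^ ?m) f t - (deriv ^^ ?m) f t'\<bar> \<le> B * \<bar>t - t'\<bar> powr (\<gamma> - ?m)"
      "\<bar>(deriv ^^ ?m) g t - (deriv ^^ ?m) g t'\<bar> \<le> B' * \<bar>t - t'\<bar> powr (\<gamma> - ?m)"
      using f g by (auto simp: holder_class_def)
    then show "\<bar>?D ?m t - ?D ?m t'\<bar> \<le> (B + B') * \<bar>t - t'\<bar> powr (\<gamma> - ?m)"
      by (simp add: distrib_right)
  qed
  then show ?thesis
    by simp
qed

lemma holder_class_mono:
  assumes "f \<in> holder_class \<gamma> B" "B \<le> B'"
  shows "f \<in> holder_class \<gamma> B'"
proof -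
  have "B * \<bar>t - t'\<bar> powr p \<le> B' * \<bar>t - t'\<bar> powr p" for t t' p
    using assms(2) by (intro mult_right_mono) auto
  then show ?thesis
    using assms(1) unfolding holder_class_def by (blast intro: order_trans)
qed

lemma strict_floor_bounds:
  assumes "\<gamma> > 0"
  shows "real (strict_floor \<gamma>) < \<gamma>" "\<gamma> \<le> real (strict_floor \<gamma>) + 1"
proof -
  have "real (strict_floor \<gamma>) = of_int (\<lceil>\<gamma>\<rceil> - 1)"
    using assms by (simp add: strict_floor_def)
  then show "real (strict_floor \<gamma>) < \<gamma>" "\<gamma> \<le> real (strict_floor \<gamma>) + 1"
    by linarith+
qed

lemma holder_class_continuous:
  assumes "\<gamma> > 0" and f: "f \<in> holder_class \<gamma> B"
  shows "continuous_on UNIV f"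
proof (cases "strict_floor \<gamma> = 0")
  case True
  have "(f \<longlongrightarrow> f t) (at t)" for t
  proof -
    have "((\<lambda>x. B * \<bar>x - t\<bar> powr \<gamma>) \<longlongrightarrow> B * \<bar>t - t\<bar> powr \<gamma>) (at t)"
      using \<open>\<gamma> > 0\<close> by (intro tendsto_intros) auto
    moreover have "norm (f x - f t) \<le> B * \<bar>x - t\<bar> powr \<gamma>" for x
      using f True by (simp add: holder_class_def)
    ultimately have "((\<lambda>x. f x - f t) \<longlongrightarrow> 0) (at t)"
      by (intro Lim_null_comparison[of "\<lambda>x. f x - f t" "\<lambda>x. B * \<bar>x - t\<bar> powr \<gamma>"])
        auto
    then show ?thesis
      by (simp add: LIM_zero_iff)
  qed
  then show ?thesis
    by (simp add: continuous_on_eq_continuous_at continuous_at)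
next
  case False
  then show ?thesis
    using holder_class_DERIV[OF f, of 0]
    by (auto intro!: continuous_at_imp_continuous_on DERIV_isCont)
qed

section \<open>Spline bumps and their scaling\<close>

lemma DERIV_pos_part_power:
  "((\<lambda>u::real. max 0 u ^ Suc (Suc k)) has_real_derivative real (Suc (Suc k)) * max 0 u ^ Suc k) (at u)"
proof -
  consider "u > 0" | "u < 0" | "u = 0"
    by linarith
  then show ?thesis
  proof cases
    case 1
    have "((\<lambda>u. u ^ Suc (Suc k)) has_real_derivative real (Suc (Suc k)) * u ^ Suc k) (at u)"
      using DERIV_pow[of "Suc (Suc k)" u UNIV] by simp
    then have "((\<lambda>u. max 0 u ^ Suc (Suc k)) has_real_derivative real (Suc (Suc k)) * u ^ Suc k) (at u)"
      by (rule has_field_derivative_transform_within_open[where S = "{0<..}"]) (use 1 in auto)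
    then show ?thesis
      using 1 by simp
  next
    case 2
    have "((\<lambda>u. 0) has_real_derivative 0) (at u)"
      by simp
    then have "((\<lambda>u. max 0 u ^ Suc (Suc k)) has_real_derivative 0) (at u)"
      by (rule has_field_derivative_transform_within_open[where S = "{..<0}"]) (use 2 in auto)
    then show ?thesis
      using 2 by simp
  next
    case 3
    \<comment> \<open>At the kink the difference quotient is at most
      \<open>\<bar>h\<bar> ^ Suc k\<close>; here it matters that the exponent is at least 2.\<close>
    have "((\<lambda>h::real. max 0 h ^ Suc (Suc k) / h) \<longlongrightarrow> 0) (at 0)"
    proof (rule Lim_null_comparison)
      show "((\<lambda>h::real. \<bar>h\<bar> ^ Suc k) \<longlongrightarrow> 0) (at 0)"
        by (auto intro!: tendsto_eq_intros)
      have "norm (max 0 h ^ Suc (Suc k) / h) \<le> \<bar>h\<bar> ^ Suc k" for h :: real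
        by (cases "h > 0") (simp_all add: max_absorb1 not_less mult_nonpos_nonneg)
      then show "\<forall>\<^sub>F h in at 0. norm (max 0 h ^ Suc (Suc k) / h) \<le> \<bar>h :: real\<bar> ^ Suc k"
        by simp
    qed
    then show ?thesis
      using 3 by (simp add: DERIV_def)
  qed
qed

text \<open>The functions \<open>bump_deriv m k\<close> with \<open>k \<le> m + 1\<close> are the derivatives of the spline
  \<open>(1 - x\<^sup>2)\<^sub>+ ^ (m + 3)\<close>.\<close>
primrec bump_poly :: "nat \<Rightarrow> nat \<Rightarrow> real poly" where
  "bump_poly m 0 = 1"
| "bump_poly m (Suc k) = pderiv (bump_poly m k) * [:1, 0, -1:]
     - smult (2 * real (m + 3 - k)) ([:0, 1:] * bump_poly m k)"

definition bump_deriv :: "nat \<Rightarrow> nat \<Rightarrow> real \<Rightarrow> real" where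
  "bump_deriv m k x = poly (bump_poly m k) x * max 0 (1 - x\<^sup>2) ^ (m + 3 - k)"

text \<open>Let \<open>u\<close> be the positive part of \<open>1 - x\<^sup>2\<close>. The
  derivative of \<open>q * u ^ e\<close> is
  \<open>(q' * (1 - x\<^sup>2) - 2 * e * x * q) * u ^ (e - 1)\<close>, which is the recursion of
  \<open>bump_poly\<close>. For \<open>k \<le> m\<close> the exponent \<open>m + 3 - k\<close> is at
  least 3, so the power is differentiable at the edges as well.\<close>

lemma DERIV_bump_deriv:
  assumes "k \<le> m"
  shows "(bump_deriv m k has_real_derivative bump_deriv m (Suc k) x) (at x)"
proof -
  define e where "e = m + 1 - k"
  have e: "m + 3 - k = Suc (Suc e)" "m + 3 - Suc k = Suc e"
    using assms by (auto simp: e_def)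
  have "((\<lambda>x. max 0 (1 - x\<^sup>2) ^ Suc (Suc e)) has_real_derivative
      real (Suc (Suc e)) * max 0 (1 - x\<^sup>2) ^ Suc e * (- 2 * x)) (at x)"
    by (rule DERIV_chain2[OF DERIV_pos_part_power]) (auto intro!: derivative_eq_intros)
  then have "((\<lambda>x. poly (bump_poly m k) x * max 0 (1 - x\<^sup>2) ^ Suc (Suc e)) has_real_derivative
      poly (pderiv (bump_poly m k)) x * max 0 (1 - x\<^sup>2) ^ Suc (Suc e) +
      real (Suc (Suc e)) * max 0 (1 - x\<^sup>2) ^ Suc e * (- 2 * x) * poly (bump_poly m k) x) (at x)"
    by (rule DERIV_mult[OF poly_DERIV])
  moreover have "max 0 (1 - x\<^sup>2) ^ Suc (Suc e) = (1 - x\<^sup>2) * max 0 (1 - x\<^sup>2) ^ Suc e"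
    by (simp add: max_def)
  ultimately show ?thesis
    unfolding bump_deriv_def[abs_def] e bump_poly.simps
    by (elim DERIV_cong, simp only: poly_diff poly_mult poly_smult poly_pCons poly_0 of_nat_Suc)
      (simp add: algebra_simps power2_eq_square del: power_Suc)
qed

lemma bump_deriv_outside: "k \<le> Suc m \<Longrightarrow> \<bar>x\<bar> \<ge> 1 \<Longrightarrow> bump_deriv m k x = 0"
  using abs_le_square_iff[of 1 x] by (simp add: bump_deriv_def max_absorb1)

lemma bump_deriv_0: "bump_deriv m 0 0 = 1" "0 \<le> bump_deriv m 0 x" "bump_deriv m 0 x \<le> 1"
  by (auto simp: bump_deriv_def intro!: power_le_one)

text \<open>\<open>SOME\<close> makes the bound a function of \<open>m\<close> alone, so that it can
  enter \<open>C\<^sub>0\<close>, which is fixed before all other parameters. Order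
  \<open>m + 1\<close> is included for the Lipschitz constant of the \<open>m\<close>-th
  derivative.\<close>

definition bump_bound :: "nat \<Rightarrow> real" where
  "bump_bound m = (SOME M. M \<ge> 1 \<and> (\<forall>k \<le> Suc m. \<forall>x. \<bar>bump_deriv m k x\<bar> \<le> M))"

lemma bump_bound:
  shows bump_bound_ge_1: "bump_bound m \<ge> 1"
    and bump_deriv_le: "k \<le> Suc m \<Longrightarrow> \<bar>bump_deriv m k x\<bar> \<le> bump_bound m"
proof -
  have "\<exists>M. \<forall>x. \<bar>bump_deriv m k x\<bar> \<le> M" if "k \<le> Suc m" for k
  proof -
    have "continuous_on {-1..1} (bump_deriv m k)"
      unfolding bump_deriv_def[abs_def] by (intro continuous_intros)
    then have "bounded (bump_deriv m k ` {-1..1})"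
      by (intro compact_imp_bounded compact_continuous_image) auto
    then obtain M where M: "\<forall>x\<in>{-1..1}. \<bar>bump_deriv m k x\<bar> \<le> M"
      unfolding bounded_iff by auto
    then have "\<bar>bump_deriv m k x\<bar> \<le> max 0 M" for x
      using bump_deriv_outside[OF that, of x] M by (cases "x \<in> {-1..1}") (auto simp: max.coboundedI2)
    then show ?thesis
      by blast
  qed
  then obtain M where M: "\<And>k x. k \<le> Suc m \<Longrightarrow> \<bar>bump_deriv m k x\<bar> \<le> M k"
    by metis
  have "\<exists>M. M \<ge> 1 \<and> (\<forall>k \<le> Suc m. \<forall>x. \<bar>bump_deriv m k x\<bar> \<le> M)"
  proof (intro exI conjI allI impI)
    show "1 \<le> Max (insert 1 (M ` {..Suc m}))"
      by simp
    show "\<bar>bump_deriv m k x\<bar> \<le> Max (insert 1 (M ` {..Suc m}))" if "k \<le> Suc m" for k x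
      using M[OF that, of x] that by (intro order_trans[OF _ Max_ge]) auto
  qed
  from someI_ex[OF this] show "bump_bound m \<ge> 1"
    "k \<le> Suc m \<Longrightarrow> \<bar>bump_deriv m k x\<bar> \<le> bump_bound m"
    unfolding bump_bound_def by blast+
qed

text \<open>Interpolation: at distance at most 1 the Lipschitz bound is the stronger one, at larger
  distance twice the supremum suffices.\<close>

lemma bump_deriv_holder:
  assumes "0 < \<delta>" "\<delta> \<le> 1"
  shows "\<bar>bump_deriv m m x - bump_deriv m m y\<bar> \<le> 2 * bump_bound m * \<bar>x - y\<bar> powr \<delta>"
proof (cases "\<bar>x - y\<bar> \<le> 1")
  case True
  have "norm (bump_deriv m m x - bump_deriv m m y) \<le> bump_bound m * norm (x - y)"
    by (rule field_differentiable_bound[of UNIV])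
      (auto intro: DERIV_bump_deriv bump_deriv_le)
  also have "\<dots> \<le> bump_bound m * (2 * \<bar>x - y\<bar> powr \<delta>)"
  proof (intro mult_left_mono)
    have "\<bar>x - y\<bar> \<le> \<bar>x - y\<bar> powr \<delta>"
      using powr_mono'[of \<delta> 1 "\<bar>x - y\<bar>"] assms True by (cases "x = y") auto
    then show "norm (x - y) \<le> 2 * \<bar>x - y\<bar> powr \<delta>"
      by simp
  qed (use bump_bound_ge_1[of m] in auto)
  finally show ?thesis
    by simp
next
  case False
  then have "1 \<le> \<bar>x - y\<bar> powr \<delta>"
    using assms by (intro ge_one_powr_ge_zero) auto
  then have "2 * bump_bound m * 1 \<le> 2 * bump_bound m * \<bar>x - y\<bar> powr \<delta>"
    using bump_bound_ge_1[of m] by (intro mult_left_mono) auto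
  moreover have "\<bar>bump_deriv m m x - bump_deriv m m y\<bar> \<le> 2 * bump_bound m"
    using bump_deriv_le[of m m x] bump_deriv_le[of m m y] by simp
  ultimately show ?thesis
    by simp
qed

lemma DERIV_scaled_bump:
  assumes "k \<le> m"
  shows "((\<lambda>x. c * a ^ k * bump_deriv m k (a * x - b)) has_real_derivative
     c * a ^ Suc k * bump_deriv m (Suc k) (a * x - b)) (at x)"
proof -
  have "((\<lambda>x. bump_deriv m k (a * x - b)) has_real_derivative
      bump_deriv m (Suc k) (a * x - b) * a) (at x)"
    by (rule DERIV_chain2[OF DERIV_bump_deriv[OF assms]]) (auto intro!: derivative_eq_intros)
  from DERIV_cmult[OF this, of "c * a ^ k"] show ?thesis
    by (simp add: mult_ac)
qed

text \<open>The \<open>m\<close> derivatives contribute \<open>a ^ m\<close> and the Hoelder modulus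
  \<open>a powr (\<gamma> - m)\<close>, together \<open>a powr \<gamma>\<close>.\<close>

lemma scaled_bump_holder:
  assumes "m = strict_floor \<gamma>" "\<gamma> > 0" "a > 0"
  shows "\<bar>c * a ^ m * bump_deriv m m (a * x - b) - c * a ^ m * bump_deriv m m (a * y - b)\<bar>
     \<le> 2 * bump_bound m * \<bar>c\<bar> * a powr \<gamma> * \<bar>x - y\<bar> powr (\<gamma> - m)"
proof -
  let ?d = "bump_deriv m m (a * x - b) - bump_deriv m m (a * y - b)"
  have \<delta>: "0 < \<gamma> - m" "\<gamma> - m \<le> 1"
    using strict_floor_bounds[OF assms(2)] by (auto simp: assms(1))
  have "\<bar>c * a ^ m * bump_deriv m m (a * x - b) - c * a ^ m * bump_deriv m m (a * y - b)\<bar>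
      = \<bar>c\<bar> * a ^ m * \<bar>?d\<bar>"
    using assms(3) by (simp add: abs_mult flip: right_diff_distrib)
  also have "\<dots> \<le> \<bar>c\<bar> * a ^ m * (2 * bump_bound m * \<bar>(a * x - b) - (a * y - b)\<bar> powr (\<gamma> - m))"
    using assms(3) by (intro mult_left_mono bump_deriv_holder \<delta>) auto
  also have "(a * x - b) - (a * y - b) = a * (x - y)"
    by (simp add: algebra_simps)
  also have "\<bar>a * (x - y)\<bar> powr (\<gamma> - m) = a powr (\<gamma> - m) * \<bar>x - y\<bar> powr (\<gamma> - m)"
    using assms(3) by (simp add: abs_mult powr_mult)
  also have "\<bar>c\<bar> * a ^ m * (2 * bump_bound m * (a powr (\<gamma> - m) * \<bar>x - y\<bar> powr (\<gamma> - m)))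
      = 2 * bump_bound m * \<bar>c\<bar> * (a powr m * a powr (\<gamma> - m)) * \<bar>x - y\<bar> powr (\<gamma> - m)"
    using assms(3) by (simp add: powr_realpow mult_ac)
  also have "a powr m * a powr (\<gamma> - m) = a powr \<gamma>"
    by (simp flip: powr_add)
  finally show ?thesis .
qed

lemma scaled_bump_in_holder_class:
  assumes "m = strict_floor \<gamma>" "\<gamma> > 0" "a > 0"
  shows "(\<lambda>x. c * bump_deriv m 0 (a * x - b)) \<in> holder_class \<gamma> (2 * bump_bound m * \<bar>c\<bar> * a powr \<gamma>)"
proof -
  let ?D = "\<lambda>k x. c * a ^ k * bump_deriv m k (a * x - b)"
  have "?D 0 \<in> holder_class \<gamma> (2 * bump_bound m * \<bar>c\<bar> * a powr \<gamma>)"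
  proof (rule holder_classI)
    show "(?D k has_real_derivative ?D (Suc k) x) (at x)" if "k < strict_floor \<gamma>" for k x
      using that assms(1) by (intro DERIV_scaled_bump) simp
    show "\<bar>?D (strict_floor \<gamma>) t - ?D (strict_floor \<gamma>) t'\<bar>
        \<le> 2 * bump_bound m * \<bar>c\<bar> * a powr \<gamma> * \<bar>t - t'\<bar> powr (\<gamma> - strict_floor \<gamma>)" for t t'
      using scaled_bump_holder[OF assms, of c t b t'] by (simp flip: assms(1))
  qed
  then show ?thesis
    by simp
qed

section \<open>A self-similar function\<close>

lemma holder_class_cmult:
  assumes f: "f \<in> holder_class \<gamma> B" and "c \<ge> 0"
  shows "(\<lambda>x. c * f x) \<in> holder_class \<gamma> (c * B)"
proof -
  let ?m = "strict_floor \<gamma>"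
  let ?D = "\<lambda>k x. c * (deriv ^^ k) f x"
  have "?D 0 \<in> holder_class \<gamma> (c * B)"
  proof (rule holder_classI)
    show "(?D k has_real_derivative ?D (Suc k) x) (at x)" if "k < ?m" for k x
      using holder_class_DERIV[OF f that] by (rule DERIV_cmult)
    fix t t'
    have "\<bar>(deriv ^^ ?m) f t - (deriv ^^ ?m) f t'\<bar> \<le> B * \<bar>t - t'\<bar> powr (\<gamma> - ?m)"
      using f by (auto simp: holder_class_def)
    from mult_left_mono[OF this \<open>c \<ge> 0\<close>]
    show "\<bar>?D ?m t - ?D ?m t'\<bar> \<le> c * B * \<bar>t - t'\<bar> powr (\<gamma> - ?m)"
      using \<open>c \<ge> 0\<close> by (simp add: abs_mult mult.assoc flip: right_diff_distrib)
  qed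
  then show ?thesis
    by simp
qed

text \<open>The \<open>k\<close>-th derivative of the lacunary superposition of bumps with centres
  \<open>p / 2 ^ i\<close>, widths \<open>1 / (R * 2 ^ i)\<close> and heights \<open>2 powr (- i * \<gamma>)\<close>.\<close>
definition lacunary :: "real \<Rightarrow> real \<Rightarrow> real \<Rightarrow> nat \<Rightarrow> real \<Rightarrow> real" where
  "lacunary \<gamma> R p k x = (\<Sum>i. 2 powr (- (real i * \<gamma>)) * (R * 2 ^ i) ^ k *
     bump_deriv (strict_floor \<gamma>) k (R * 2 ^ i * x - R * p))"

text \<open>Termwise differentiation: the terms of the \<open>k\<close>-th derivative decay like
  \<open>2 powr (- i * (\<gamma> - k))\<close>, which is summable up to
  \<open>k = strict_floor \<gamma>\<close> because this integer is strictly below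
  \<open>\<gamma>\<close>.\<close>

lemma DERIV_lacunary:
  assumes "\<gamma> > 0" "R > 0" "k < strict_floor \<gamma>"
  shows "(lacunary \<gamma> R p k has_real_derivative lacunary \<gamma> R p (Suc k) x) (at x)"
proof -
  let ?m = "strict_floor \<gamma>"
  let ?t = "\<lambda>k i x. 2 powr (- (real i * \<gamma>)) * (R * 2 ^ i) ^ k * bump_deriv ?m k (R * 2 ^ i * x - R * p)"
  have bound: "norm (?t k i x) \<le> bump_bound ?m * R ^ k * (2 powr (- (\<gamma> - k))) ^ i"
    if "k \<le> ?m" for k i x
  proof -
    have "2 powr (- (real i * \<gamma>)) * (2 ^ i) ^ k = (2 powr (- (\<gamma> - k))) ^ i"
    proof -
      have "(2 ^ i) ^ k = (2 powr (real i * real k) :: real)"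
        by (simp add: powr_realpow flip: power_mult of_nat_mult)
      moreover have "(2 powr (- (\<gamma> - k))) ^ i = 2 powr (- (\<gamma> - k) * real i)"
        by (simp add: powr_powr flip: powr_realpow)
      ultimately show ?thesis
        by (simp add: algebra_simps flip: powr_add)
    qed
    moreover have "norm (?t k i x)
        = R ^ k * (2 powr (- (real i * \<gamma>)) * (2 ^ i) ^ k) * \<bar>bump_deriv ?m k (R * 2 ^ i * x - R * p)\<bar>"
      using \<open>R > 0\<close> by (simp add: abs_mult power_mult_distrib)
    moreover have "\<bar>bump_deriv ?m k (R * 2 ^ i * x - R * p)\<bar> \<le> bump_bound ?m"
      using that by (intro bump_deriv_le) simp
    ultimately show ?thesis
      using \<open>R > 0\<close> by (simp add: mult_ac mult_left_mono)
  qed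
  have summable: "summable (\<lambda>i. bump_bound ?m * R ^ k * (2 powr (- (\<gamma> - real k))) ^ i)" if "k \<le> ?m" for k
  proof -
    have "2 powr (- (\<gamma> - real k)) < (1 :: real)"
      using strict_floor_bounds(1)[OF \<open>\<gamma> > 0\<close>] that by (intro powr_less_one) auto
    then show ?thesis
      by (intro summable_mult summable_geometric) simp
  qed
  have "((\<lambda>x. \<Sum>i. ?t k i x) has_real_derivative (\<Sum>i. ?t (Suc k) i x)) (at x)"
  proof (rule has_field_derivative_series'(2)[of UNIV "?t k" "?t (Suc k)" 0 x])
    show "(?t k i has_real_derivative ?t (Suc k) i x) (at x)" for i x
      using assms(3) by (intro DERIV_scaled_bump) simp
    show "uniformly_convergent_on UNIV (\<lambda>n x. \<Sum>i<n. ?t (Suc k) i x)"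
      using assms(3) by (intro Weierstrass_m_test'[OF bound summable]) auto
    show "summable (\<lambda>i. ?t k i 0)"
      using assms(3) by (intro summable_comparison_test'[OF summable bound]) auto
  qed auto
  then show ?thesis
    by (simp add: lacunary_def[abs_def])
qed

text \<open>If \<open>2 ^ j * x\<close> is within \<open>C\<close> of \<open>p\<close>, then
  \<open>2 ^ i * x\<close> is at most \<open>(p + C) / 2\<close> for \<open>i < j\<close> and at
  least \<open>2 * (p - C)\<close> for \<open>i > j\<close>; the condition on \<open>p\<close> keeps
  both at distance at least 1 from \<open>p\<close>. With \<open>C\<close> a kernel radius, the
  window that the kernel sees from a bump centre meets no other bump.\<close>

lemma lacunary_separation:
  fixes i j :: nat and x p C R :: real
  assumes "C \<ge> 1" "p \<ge> 2 * C + 2" "R \<ge> 1" and x: "\<bar>2 ^ j * x - p\<bar> \<le> C" and "i \<noteq> j"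
  shows "\<bar>R * 2 ^ i * x - R * p\<bar> \<ge> 1"
proof -
  have x_pos: "x > 0"
  proof (rule ccontr)
    assume "\<not> x > 0"
    then have "2 ^ j * x \<le> 0"
      by (simp add: mult_nonneg_nonpos)
    then show False
      using assms by linarith
  qed
  have "\<bar>2 ^ i * x - p\<bar> \<ge> 1"
  proof (cases "i < j")
    case True
    have "(2::real) ^ Suc i \<le> 2 ^ j"
      using True by (intro power_increasing) auto
    then have "2 ^ Suc i * x \<le> 2 ^ j * x"
      using x_pos by (intro mult_right_mono) auto
    then show ?thesis
      using assms by auto
  next
    case False
    with \<open>i \<noteq> j\<close> have "(2::real) ^ Suc j \<le> 2 ^ i"
      by (intro power_increasing) auto
    then have "2 ^ Suc j * x \<le> 2 ^ i * x"
      using x_pos by (intro mult_right_mono) auto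
    then show ?thesis
      using assms by auto
  qed
  then have "1 * 1 \<le> R * \<bar>2 ^ i * x - p\<bar>"
    using \<open>R \<ge> 1\<close> by (intro mult_mono) auto
  also have "\<dots> = \<bar>R * (2 ^ i * x - p)\<bar>"
    using \<open>R \<ge> 1\<close> by (simp add: abs_mult)
  also have "R * (2 ^ i * x - p) = R * 2 ^ i * x - R * p"
    by (simp add: algebra_simps)
  finally show ?thesis
    by simp
qed

text \<open>In the variable \<open>v = 2 ^ j * x - p\<close> the profile is the same at every scale
  up to its height, which makes the bias exactly proportional to
  \<open>2 powr (- j * \<gamma>)\<close>.\<close>

lemma lacunary_near_centre:
  assumes "C \<ge> 1" "p \<ge> 2 * C + 2" "R \<ge> 1" "\<bar>v\<bar> \<le> C"
  shows "lacunary \<gamma> R p 0 ((v + p) / 2 ^ j)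
    = 2 powr (- (real j * \<gamma>)) * bump_deriv (strict_floor \<gamma>) 0 (R * v)"
proof -
  let ?x = "(v + p) / 2 ^ j"
  have "bump_deriv (strict_floor \<gamma>) 0 (R * 2 ^ i * ?x - R * p) = 0" if "i \<noteq> j" for i
    using assms that by (intro bump_deriv_outside lacunary_separation[of C p R j]) auto
  then have "lacunary \<gamma> R p 0 ?x = (\<Sum>i\<in>{j}. 2 powr (- (real i * \<gamma>)) * (R * 2 ^ i) ^ 0 *
     bump_deriv (strict_floor \<gamma>) 0 (R * 2 ^ i * ?x - R * p))"
    unfolding lacunary_def by (intro suminf_finite) auto
  moreover have "R * 2 ^ j * ?x - R * p = R * v"
    by (simp add: algebra_simps add_divide_distrib)
  ultimately show ?thesis
    by simp
qed

text \<open>The heights are such that every term has the same Hoelder constant, so these constants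
  cannot be summed. But at each point at most one term is nonzero, so a difference of two values
  involves at most two terms, at the price of a factor 2.\<close>

lemma lacunary_holder:
  assumes "\<gamma> > 0" "p \<ge> 4" "R \<ge> 1"
  shows "lacunary \<gamma> R p 0 \<in> holder_class \<gamma> (4 * bump_bound (strict_floor \<gamma>) * R powr \<gamma>)"
proof (rule holder_classI)
  let ?m = "strict_floor \<gamma>"
  let ?c = "\<lambda>i. 2 powr (- (real i * \<gamma>))"
  let ?t = "\<lambda>i x. ?c i * (R * 2 ^ i) ^ ?m * bump_deriv ?m ?m (R * 2 ^ i * x - R * p)"
  show "(lacunary \<gamma> R p k has_real_derivative lacunary \<gamma> R p (Suc k) x) (at x)" if "k < ?m" for k x
    using assms that by (intro DERIV_lacunary) auto
  have single: "\<exists>i. \<forall>i'. i' \<noteq> i \<longrightarrow> ?t i' x = 0" for x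
  proof (cases "\<exists>i. \<bar>2 ^ i * x - p\<bar> \<le> 1")
    case True
    then obtain i where "\<bar>2 ^ i * x - p\<bar> \<le> 1" ..
    then show ?thesis
      using assms
      by (intro exI[of _ i])
        (auto intro!: bump_deriv_outside lacunary_separation[where C = 1 and j = i])
  next
    case False
    have "?t i x = 0" for i
    proof -
      have "1 * 1 \<le> R * \<bar>2 ^ i * x - p\<bar>"
        using False assms(3) by (intro mult_mono) (auto simp: not_le less_imp_le)
      also have "\<dots> = \<bar>R * (2 ^ i * x - p)\<bar>"
        using assms(3) by (simp add: abs_mult)
      finally show ?thesis
        by (simp add: bump_deriv_outside right_diff_distrib mult.assoc)
    qed
    then show ?thesis
      by blast
  qed
  fix t t'
  obtain i i' where i: "\<And>k. k \<noteq> i \<Longrightarrow> ?t k t = 0" "\<And>k. k \<noteq> i' \<Longrightarrow> ?t k t' = 0"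
    using single[of t] single[of t'] by blast
  have sums: "lacunary \<gamma> R p ?m t = (\<Sum>k\<in>{i, i'}. ?t k t)" "lacunary \<gamma> R p ?m t' = (\<Sum>k\<in>{i, i'}. ?t k t')"
    unfolding lacunary_def using i by (intro suminf_finite; auto)+
  let ?L = "2 * bump_bound ?m * R powr \<gamma>"
  have "\<bar>?t k t - ?t k t'\<bar> \<le> ?L * \<bar>t - t'\<bar> powr (\<gamma> - ?m)" for k
  proof -
    have "\<bar>?t k t - ?t k t'\<bar> \<le> 2 * bump_bound ?m * \<bar>?c k\<bar> * (R * 2 ^ k) powr \<gamma> * \<bar>t - t'\<bar> powr (\<gamma> - ?m)"
      using assms by (intro scaled_bump_holder) auto
    also have "\<bar>?c k\<bar> * (R * 2 ^ k) powr \<gamma> = R powr \<gamma>"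
    proof -
      have "(2 ^ k) powr \<gamma> = 2 powr (real k * \<gamma>)"
        by (simp add: powr_powr flip: powr_realpow)
      then show ?thesis
        using assms(3) by (simp add: powr_mult powr_minus)
    qed
    then have "2 * bump_bound ?m * \<bar>?c k\<bar> * (R * 2 ^ k) powr \<gamma> = ?L"
      by (simp only: mult.assoc)
    finally show ?thesis .
  qed
  note each = this
  have "\<bar>lacunary \<gamma> R p ?m t - lacunary \<gamma> R p ?m t'\<bar> = \<bar>\<Sum>k\<in>{i, i'}. ?t k t - ?t k t'\<bar>"
    unfolding sums by (simp only: sum_subtractf)
  also have "\<dots> \<le> (\<Sum>k\<in>{i, i'}. \<bar>?t k t - ?t k t'\<bar>)"
    by (rule sum_abs)
  also have "\<dots> \<le> (\<Sum>k\<in>{i, i'}. ?L * \<bar>t - t'\<bar> powr (\<gamma> - ?m))"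
    by (intro sum_mono each)
  also have "\<dots> \<le> 2 * (?L * \<bar>t - t'\<bar> powr (\<gamma> - ?m))"
    using bump_bound_ge_1[of ?m] by (cases "i = i'") auto
  finally show "\<bar>lacunary \<gamma> R p ?m t - lacunary \<gamma> R p ?m t'\<bar>
      \<le> 4 * bump_bound ?m * R powr \<gamma> * \<bar>t - t'\<bar> powr (\<gamma> - ?m)"
    by simp
qed

section \<open>Compactly supported kernels and their bias on the dyadic grid\<close>

lemma kernel_bounded:
  assumes "kernel K" and C: "\<And>x y. \<bar>x - y\<bar> > C \<Longrightarrow> K y x = 0"
  obtains A where "\<And>x. \<bar>K y x\<bar> \<le> A"
proof -
  obtain V where V: "\<And>(m::nat) x. mono x \<Longrightarrow> (\<Sum>i<m. \<bar>K y (x (Suc i)) - K y (x i)\<bar>) \<le> V"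
    using assms(1) unfolding kernel_def bounded_variation_def by blast
  have "\<bar>K y x\<bar> \<le> V" for x
  proof -
    \<comment> \<open>A point to the right of \<open>x\<close> where the kernel vanishes: the single
      increment from \<open>x\<close> to \<open>z\<close> is then the value at \<open>x\<close> up
      to sign.\<close>
    define z where "z = max x (y + \<bar>C\<bar> + 1)"
    have "mono (\<lambda>i::nat. if i = 0 then x else z)"
      by (auto simp: mono_def z_def)
    from V[OF this, of 1] have "\<bar>K y z - K y x\<bar> \<le> V"
      by simp
    moreover have "K y z = 0"
      by (rule C) (auto simp: z_def)
    ultimately show ?thesis
      by simp
  qed
  then show ?thesis
    by (rule that)
qed

text \<open>At the grid point \<open>p / 2 ^ j\<close>, translation invariance reduces \<open>K\<^sub>j\<close> to the single
  function \<open>K 0\<close>.\<close>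
lemma kernel_op_grid_point:
  assumes C: "\<And>x y. \<bar>x - y\<bar> > C \<Longrightarrow> K y x = 0"
    and shift: "\<And>(k::int) x y. K y x = K (y - of_int k) (x - of_int k)"
    and f: "\<And>v. \<bar>v\<bar> \<le> C \<Longrightarrow> f ((v + of_int p) / 2 ^ j) = h v"
  shows "kernel_op K (int j) f (of_int p / 2 ^ j) = (LINT v|lborel. K 0 v * h v)"
proof -
  have "kernel_op K (int j) f (of_int p / 2 ^ j) = (LINT x|lborel. 2 ^ j * K (of_int p) (2 ^ j * x) * f x)"
    by (simp add: kernel_op_def scaled_kernel_def)
  also have "\<dots> = \<bar>1 / 2 ^ j\<bar> *\<^sub>R (LINT v|lborel. 2 ^ j * K (of_int p) (2 ^ j * (of_int p / 2 ^ j + 1 / 2 ^ j * v))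
      * f (of_int p / 2 ^ j + 1 / 2 ^ j * v))"
    by (rule lborel_integral_real_affine) simp
  also have "\<dots> = \<bar>1 / 2 ^ j\<bar> *\<^sub>R (LINT v|lborel. 2 ^ j * (K 0 v * h v))"
  proof -
    have "2 ^ j * K (of_int p) (2 ^ j * (of_int p / 2 ^ j + 1 / 2 ^ j * v)) * f (of_int p / 2 ^ j + 1 / 2 ^ j * v)
        = 2 ^ j * (K 0 v * h v)" for v
    proof -
      have "K (of_int p) (2 ^ j * (of_int p / 2 ^ j + 1 / 2 ^ j * v)) = K 0 v"
        by (subst shift[of _ _ p]) (simp add: field_simps)
      \<comment> \<open>The values of \<open>f\<close> are prescribed only for
        \<open>\<bar>v\<bar> \<le> C\<close>; elsewhere the kernel factor vanishes.\<close>
      moreover have "K 0 v = 0 \<or> f (of_int p / 2 ^ j + 1 / 2 ^ j * v) = h v"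
        using C[of v 0] f[of v] by (cases "\<bar>v\<bar> \<le> C") (auto simp: field_simps)
      ultimately show ?thesis
        by auto
    qed
    then show ?thesis
      by (simp only:)
  qed
  finally show ?thesis
    by simp
qed

text \<open>At a centre the function equals the height of the bump, while the bounded function
  \<open>K 0\<close> averages a narrow bump to at most half that height. A perturbation
  \<open>g\<close> is harmless because it vanishes on the whole window seen from the centre.\<close>

lemma self_similar_function:
  assumes "\<gamma> > 0" "kernel K"
    and C: "\<exists>C. \<forall>x y. \<bar>x - y\<bar> > C \<longrightarrow> K y x = 0"
    and shift: "\<forall>(k::int) x y. K y x = K (y - of_int k) (x - of_int k)"
  obtains j\<^sub>0 :: int and \<kappa> :: real where "0 < \<kappa>" "\<kappa> \<le> 1"
    "\<forall>B>0. \<exists>f\<in>holder_class \<gamma> (B / 2). \<forall>g j. j\<^sub>0 \<le> j \<longrightarrow> (\<forall>x\<le>1/2. g x = 0) \<longrightarrow>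
       (\<exists>t\<in>{0..1}. \<kappa> * B * 2 powr (- (of_int j * \<gamma>)) \<le> \<bar>kernel_op K j (\<lambda>x. f x + g x) t - (f t + g t)\<bar>)"
proof -
  let ?m = "strict_floor \<gamma>"
  obtain C0 where C0: "\<And>x y. \<bar>x - y\<bar> > C0 \<Longrightarrow> K y x = 0"
    using C by blast
  obtain A where A: "\<And>x. \<bar>K 0 x\<bar> \<le> A"
    using kernel_bounded[OF \<open>kernel K\<close> C0] by blast
  define C where "C = max 1 C0"
  have C: "C \<ge> 1" "\<And>x y. \<bar>x - y\<bar> > C \<Longrightarrow> K y x = 0"
    using C0 by (auto simp: C_def)
  define p where "p = \<lceil>2 * C + 2\<rceil>"
  have p: "real_of_int p \<ge> 2 * C + 2"
    by (simp add: p_def)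
  \<comment> \<open>The average of a bump of half-width \<open>1 / R\<close> against a kernel
    bounded by \<open>A\<close> is at most \<open>2 * A / R\<close>, which
    \<open>R \<ge> 4 * A\<close> makes at most \<open>1 / 2\<close>.\<close>
  define R where "R = max 1 (4 * A)"
  have R: "R \<ge> 1" "R \<ge> 4 * A"
    by (auto simp: R_def)
  \<comment> \<open>Twice the constant of \<open>lacunary_holder\<close>, so that multiplying by
    \<open>B / D\<close> gives the class with constant \<open>B / 2\<close>. Half of the height
    factor \<open>1 / D\<close> then survives as bias, which is the witness
    \<open>1 / (2 * D)\<close> for \<open>\<kappa>\<close>.\<close>
  define D where "D = 8 * bump_bound ?m * R powr \<gamma>"
  have "1 * 1 \<le> bump_bound ?m * R powr \<gamma>"
    using R \<open>\<gamma> > 0\<close> bump_bound_ge_1[of ?m] by (intro mult_mono ge_one_powr_ge_zero) auto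
  then have D: "D \<ge> 8"
    by (simp add: D_def)
  obtain j\<^sub>0 where j\<^sub>0: "2 * (of_int p + C) < 2 ^ j\<^sub>0"
    using real_arch_pow[of 2 "2 * (of_int p + C)"] by auto
  define \<kappa>0 where "\<kappa>0 = (LINT v|lborel. K 0 v * bump_deriv ?m 0 (R * v))"
  \<comment> \<open>An upper bound suffices, since a very negative \<open>\<kappa>0\<close> only
    increases the bias factor \<open>\<bar>\<kappa>0 - 1\<bar>\<close>.\<close>
  have "\<kappa>0 \<le> (LINT v|lborel. A * indicator {-1/R..1/R} v)"
    unfolding \<kappa>0_def
  proof (rule integral_mono')
    show "integrable lborel (\<lambda>v. A * indicator {-1/R..1/R} v)"
      by (intro integrable_mult_right integrable_real_indicator) (auto simp: emeasure_lborel_Icc_eq)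
    have "A \<ge> 0"
      using A[of 0] by linarith
    then show "0 \<le> A * indicator {-1/R..1/R} v" for v
      by simp
    show "K 0 v * bump_deriv ?m 0 (R * v) \<le> A * indicator {-1/R..1/R} v" for v
    proof (cases "v \<in> {-1/R..1/R}")
      case True
      have "K 0 v * bump_deriv ?m 0 (R * v) \<le> A * 1"
        using A[of v] \<open>A \<ge> 0\<close> by (intro mult_mono bump_deriv_0) auto
      then show ?thesis
        using True by simp
    next
      case False
      then have "\<bar>v\<bar> \<ge> 1 / R"
        by auto
      then have "\<bar>R * v\<bar> \<ge> 1"
        using R(1) by (simp add: abs_mult field_simps)
      then show ?thesis
        using False by (simp add: bump_deriv_outside)
    qed
  qed
  also have "\<dots> = A * (2 / R)"
  proof -
    have "- 1 / R \<le> 1 / R"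
      using R by (intro divide_right_mono) auto
    then show ?thesis
      by simp
  qed
  also have "\<dots> \<le> 1 / 2"
    using R by (simp add: field_simps)
  finally have \<kappa>0: "\<kappa>0 \<le> 1 / 2" .
  show ?thesis
  proof (rule that[of "1 / (2 * D)" "int j\<^sub>0"])
    show "0 < 1 / (2 * D)" "1 / (2 * D) \<le> 1"
      using D by auto
    show "\<forall>B>0. \<exists>f\<in>holder_class \<gamma> (B / 2). \<forall>g j. int j\<^sub>0 \<le> j \<longrightarrow> (\<forall>x\<le>1/2. g x = 0) \<longrightarrow>
       (\<exists>t\<in>{0..1}. 1 / (2 * D) * B * 2 powr (- (of_int j * \<gamma>)) \<le> \<bar>kernel_op K j (\<lambda>x. f x + g x) t - (f t + g t)\<bar>)"
    proof (intro allI impI)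
      fix B :: real assume "B > 0"
      define f where "f x = (B / D) * lacunary \<gamma> R p 0 x" for x
      have "f \<in> holder_class \<gamma> (B / 2)"
      proof -
        have "B / D * (4 * bump_bound ?m * R powr \<gamma>) = B / D * (D / 2)"
          by (simp add: D_def)
        also have "\<dots> = B / 2"
          using D by simp
        finally have eq: "B / D * (4 * bump_bound ?m * R powr \<gamma>) = B / 2" .
        have "f \<in> holder_class \<gamma> (B / D * (4 * bump_bound ?m * R powr \<gamma>))"
          unfolding f_def[abs_def] using \<open>\<gamma> > 0\<close> R(1) C(1) p D \<open>B > 0\<close>
          by (intro holder_class_cmult lacunary_holder) auto
        then show ?thesis
          by (simp only: eq)
      qed
      moreover have "\<exists>t\<in>{0..1}. 1 / (2 * D) * B * 2 powr (- (of_int j * \<gamma>))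
          \<le> \<bar>kernel_op K j (\<lambda>x. f x + g x) t - (f t + g t)\<bar>"
        if j: "int j\<^sub>0 \<le> j" and g: "\<forall>x\<le>1/2. g x = 0" for g j
      proof -
        obtain i where i: "j = int i" "j\<^sub>0 \<le> i"
          using j by (metis nat_int nat_le_iff int_nat_eq of_nat_0_le_iff order_trans zero_le_imp_eq_int zle_int)
        \<comment> \<open>The purpose of \<open>j\<^sub>0\<close>: the kernel window around the
          centre lies to the left of \<open>1 / 2\<close>, where \<open>g\<close> vanishes.\<close>
        have "2 * (of_int p + C) < 2 ^ i"
          using j\<^sub>0 i(2) by (meson less_le_trans one_le_numeral power_increasing)
        then have half: "(v + of_int p) / 2 ^ i \<le> 1 / 2" if "\<bar>v\<bar> \<le> C" for v
          using that by (simp add: field_simps)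
        have near: "f ((v + of_int p) / 2 ^ i) + g ((v + of_int p) / 2 ^ i)
            = B / D * 2 powr (- (real i * \<gamma>)) * bump_deriv ?m 0 (R * v)" if "\<bar>v\<bar> \<le> C" for v
          using lacunary_near_centre[OF C(1) p R(1) that] g half[OF that] by (simp add: f_def)
        let ?t = "of_int p / 2 ^ i :: real"
        have "?t \<le> 1 / 2"
          using half[of 0] C(1) by (metis abs_zero add_0 order_trans zero_le_one)
        moreover have "?t \<ge> 0"
          using C(1) p by (intro divide_nonneg_nonneg) auto
        ultimately have t: "?t \<in> {0..1}"
          unfolding atLeastAtMost_iff by linarith
        have "kernel_op K j (\<lambda>x. f x + g x) ?t
            = (LINT v|lborel. K 0 v * (B / D * 2 powr (- (real i * \<gamma>)) * bump_deriv ?m 0 (R * v)))"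
          unfolding i(1) using C(2) shift near by (intro kernel_op_grid_point) auto
        also have "\<dots> = (LINT v|lborel. (B / D * 2 powr (- (real i * \<gamma>))) * (K 0 v * bump_deriv ?m 0 (R * v)))"
          by (simp only: mult_ac)
        also have "\<dots> = B / D * 2 powr (- (real i * \<gamma>)) * \<kappa>0"
          by (simp only: integral_mult_right_zero \<kappa>0_def)
        finally have op: "kernel_op K j (\<lambda>x. f x + g x) ?t = B / D * 2 powr (- (real i * \<gamma>)) * \<kappa>0" .
        have val: "f ?t + g ?t = B / D * 2 powr (- (real i * \<gamma>))"
          using near[of 0] C(1) by (simp add: bump_deriv_0)
        have "\<bar>kernel_op K j (\<lambda>x. f x + g x) ?t - (f ?t + g ?t)\<bar>
            = \<bar>B / D * 2 powr (- (real i * \<gamma>)) * (\<kappa>0 - 1)\<bar>"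
          unfolding op val by (simp only: right_diff_distrib mult_1_right)
        also have "\<dots> = B / D * 2 powr (- (real i * \<gamma>)) * \<bar>\<kappa>0 - 1\<bar>"
          using \<open>B > 0\<close> D by (subst abs_mult) simp
        also have "\<dots> \<ge> B / D * 2 powr (- (real i * \<gamma>)) * (1 / 2)"
          using \<kappa>0 \<open>B > 0\<close> D by (intro mult_left_mono) auto
        finally have "1 / (2 * D) * B * 2 powr (- (of_int j * \<gamma>))
            \<le> \<bar>kernel_op K j (\<lambda>x. f x + g x) ?t - (f ?t + g ?t)\<bar>"
          by (simp add: i(1))
        then show ?thesis
          using t by (rule bexI)
      qed
      ultimately show "\<exists>f\<in>holder_class \<gamma> (B / 2). \<forall>g j. int j\<^sub>0 \<le> j \<longrightarrow> (\<forall>x\<le>1/2. g x = 0) \<longrightarrow>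
         (\<exists>t\<in>{0..1}. 1 / (2 * D) * B * 2 powr (- (of_int j * \<gamma>)) \<le> \<bar>kernel_op K j (\<lambda>x. f x + g x) t - (f t + g t)\<bar>)"
        by blast
    qed
  qed
qed

section \<open>The lower bound\<close>

lemma self_sim_classI:
  assumes "f \<in> holder_class \<gamma> B"
    and "\<And>j. l \<le> j \<Longrightarrow> \<exists>t\<in>{0..1}. \<epsilon> * B * 2 powr (- (of_int j * \<gamma>)) \<le> \<bar>kernel_op K j f t - f t\<bar>"
  shows "f \<in> self_sim_class \<gamma> B \<epsilon> K l"
proof -
  have "ereal (\<epsilon> * B * 2 powr (- (of_int j * \<gamma>))) \<le> (SUP t\<in>{0..1}. ereal \<bar>kernel_op K j f t - f t\<bar>)"
    if j: "l \<le> j" for j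
  proof -
    obtain t where "t \<in> {0..1}" "\<epsilon> * B * 2 powr (- (of_int j * \<gamma>)) \<le> \<bar>kernel_op K j f t - f t\<bar>"
      using assms(2)[OF j] by blast
    then show ?thesis
      by (intro SUP_upper2[of t]) auto
  qed
  then show ?thesis
    using assms(1) by (simp add: self_sim_class_def)
qed

text \<open>The least favourable configuration: the bumps \<open>g k\<close> have smoothness constant \<open>T / 2\<close> and are
  supported in \<open>[1/2, 1]\<close>, away from the points where the self-similarity of \<open>f\<close> is
  witnessed.\<close>
lemma minimax_length_lower_bound:
  fixes \<gamma> h T \<kappa> :: real
  defines "M \<equiv> bump_bound (strict_floor \<gamma>)"
  assumes "\<gamma> > 0" and bm: "two_sided_brownian_motion \<Omega> W" and s: "s > 0"
    and f: "f \<in> holder_class \<gamma> (B / 2)"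
    and f_sim: "\<And>g j. j\<^sub>0 \<le> j \<Longrightarrow> \<forall>x\<le>1/2. g x = 0 \<Longrightarrow>
       \<exists>t\<in>{0..1}. \<kappa> * B * 2 powr (- (of_int j * \<gamma>)) \<le> \<bar>kernel_op K j (\<lambda>x. f x + g x) t - (f t + g t)\<bar>"
    and B: "0 < Bl" "Bl \<le> B" "B \<le> T" "T \<le> Bu" and \<epsilon>: "\<epsilon> \<le> \<epsilon>'" "\<epsilon>' \<le> \<kappa>" "\<epsilon> * T \<le> \<kappa> * B" and "j\<^sub>0 \<le> l"
    and h: "0 < h" "h \<le> 1 / 8"
    and \<delta>: "\<delta> > 0" "2 * \<alpha> + \<delta> < \<beta>"
    and small: "8 * h * exp ((T / (4 * M) * h powr \<gamma>)\<^sup>2 * (2 * h) / s\<^sup>2) \<le> \<delta>\<^sup>2"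
  shows "ereal (T / (4 * M) * h powr \<gamma>) \<le> minimax_length \<Omega> W \<eta> s \<alpha> \<beta>
           (self_sim_class \<gamma> B \<epsilon>' K l) (\<Union>B'\<in>{Bl..Bu}. self_sim_class \<gamma> B' \<epsilon> K l)"
proof -
  \<comment> \<open>A bump of height \<open>H\<close> and half-width \<open>h\<close> has Hoelder
    constant \<open>2 * M * H / h powr \<gamma>\<close>; setting this equal to \<open>T / 2\<close>
    gives \<open>H\<close>.\<close>
  define H where "H = T / (4 * M) * h powr \<gamma>"
  \<comment> \<open>As many disjoint bumps of width \<open>2 * h\<close> as fit into
    \<open>[1/2, 1]\<close>.\<close>
  define N where "N = nat \<lfloor>1 / (4 * h)\<rfloor>"
  define z where "z k = 1 / 2 + h * (2 * real k + 1)" for k :: nat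
  define g where "g k x = H * bump_deriv (strict_floor \<gamma>) 0 (1 / h * x - z k / h)" for k x
  let ?G = "self_sim_class \<gamma> B \<epsilon>' K l"
  let ?F = "\<Union>B'\<in>{Bl..Bu}. self_sim_class \<gamma> B' \<epsilon> K l"
  have M: "M \<ge> 1"
    unfolding M_def by (rule bump_bound_ge_1)
  have H: "H > 0"
    using M B h by (simp add: H_def)
  have arg: "1 / h * x - z k / h = (x - z k) / h" for x k
    by (simp add: diff_divide_distrib)
  have g_le: "\<bar>g k x\<bar> \<le> H" for k x
  proof -
    have "H * bump_deriv (strict_floor \<gamma>) 0 (1 / h * x - z k / h) \<le> H * 1"
      using H by (intro mult_left_mono bump_deriv_0) auto
    then show ?thesis
      using H bump_deriv_0(2) by (simp add: g_def)
  qed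
  have g_out: "g k x = 0" if "x \<notin> {z k - h..z k + h}" for k x
  proof -
    have "h \<le> \<bar>x - z k\<bar>"
      using that by auto
    then have "1 \<le> \<bar>(x - z k) / h\<bar>"
      using h by (simp add: field_simps)
    then show ?thesis
      unfolding g_def arg by (simp add: bump_deriv_outside)
  qed
  have g_left: "\<forall>x\<le>1/2. g k x = 0" for k
  proof (intro allI impI)
    fix x :: real assume "x \<le> 1 / 2"
    moreover have "h * 1 \<le> h * (2 * real k + 1)"
      using h by (intro mult_left_mono) auto
    ultimately have "h \<le> \<bar>x - z k\<bar>"
      unfolding z_def by linarith
    then have "1 \<le> \<bar>(x - z k) / h\<bar>"
      using h by (simp add: field_simps)
    then show "g k x = 0"
      unfolding g_def arg by (simp add: bump_deriv_outside)
  qed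
  have g_holder: "g k \<in> holder_class \<gamma> (T / 2)" for k
  proof -
    have "2 * M * \<bar>H\<bar> * (1 / h) powr \<gamma> = 2 * M * H / h powr \<gamma>"
      using H h by (simp add: powr_divide)
    also have "\<dots> = T / 2"
      using M h by (simp add: H_def)
    finally have eq: "2 * M * \<bar>H\<bar> * (1 / h) powr \<gamma> = T / 2" .
    have "g k \<in> holder_class \<gamma> (2 * M * \<bar>H\<bar> * (1 / h) powr \<gamma>)"
      unfolding g_def[abs_def] M_def using \<open>\<gamma> > 0\<close> h
      by (intro scaled_bump_in_holder_class) auto
    then show ?thesis
      by (simp only: eq)
  qed
  have f_G: "f \<in> ?G"
  proof (rule self_sim_classI)
    show "f \<in> holder_class \<gamma> B"
      using f by (rule holder_class_mono) (use B in simp)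
    show "\<exists>t\<in>{0..1}. \<epsilon>' * B * 2 powr (- (of_int j * \<gamma>)) \<le> \<bar>kernel_op K j f t - f t\<bar>" if j: "l \<le> j" for j
    proof -
      obtain t where t: "t \<in> {0..1}" "\<kappa> * B * 2 powr (- (of_int j * \<gamma>)) \<le> \<bar>kernel_op K j f t - f t\<bar>"
        using f_sim[of j "\<lambda>_. 0"] j \<open>j\<^sub>0 \<le> l\<close> by auto
      have "\<epsilon>' * B * 2 powr (- (of_int j * \<gamma>)) \<le> \<kappa> * B * 2 powr (- (of_int j * \<gamma>))"
        using B \<epsilon> by (intro mult_right_mono) auto
      from order_trans[OF this t(2)] t(1) show ?thesis
        by (rule bexI)
    qed
  qed
  have G_F: "?G \<subseteq> ?F"
  proof
    fix f assume "f \<in> ?G"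
    moreover have "ereal (\<epsilon> * B * 2 powr (- (of_int j * \<gamma>))) \<le> ereal (\<epsilon>' * B * 2 powr (- (of_int j * \<gamma>)))"
      for j :: int
      using B \<epsilon> by (auto intro!: mult_right_mono)
    ultimately have "f \<in> self_sim_class \<gamma> B \<epsilon> K l"
      unfolding self_sim_class_def by (blast intro: order_trans)
    then show "f \<in> ?F"
      using B by (intro UN_I[of B]) auto
  qed
  have fg_F: "(\<lambda>x. f x + g k x) \<in> ?F" for k
  proof (rule UN_I)
    show "T \<in> {Bl..Bu}"
      using B by simp
    show "(\<lambda>x. f x + g k x) \<in> self_sim_class \<gamma> T \<epsilon> K l"
    proof (rule self_sim_classI)
      show "(\<lambda>x. f x + g k x) \<in> holder_class \<gamma> T"
        using holder_class_add[OF f g_holder] by (rule holder_class_mono) (use B in simp)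
      show "\<exists>t\<in>{0..1}. \<epsilon> * T * 2 powr (- (of_int j * \<gamma>))
          \<le> \<bar>kernel_op K j (\<lambda>x. f x + g k x) t - (f t + g k t)\<bar>" if j: "l \<le> j" for j
      proof -
        obtain t where t: "t \<in> {0..1}"
          "\<kappa> * B * 2 powr (- (of_int j * \<gamma>)) \<le> \<bar>kernel_op K j (\<lambda>x. f x + g k x) t - (f t + g k t)\<bar>"
          using f_sim[of j "g k"] j \<open>j\<^sub>0 \<le> l\<close> g_left by auto
        have "\<epsilon> * T * 2 powr (- (of_int j * \<gamma>)) \<le> \<kappa> * B * 2 powr (- (of_int j * \<gamma>))"
          using \<epsilon> by (intro mult_right_mono) auto
        from order_trans[OF this t(2)] t(1) show ?thesis
          by (rule bexI)
      qed
    qed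
  qed
  \<comment> \<open>By \<open>h \<le> 1 / 8\<close> the floor loses at most half, so
    \<open>N\<close> is at least \<open>1 / (8 * h)\<close>; hence the factor \<open>8 * h\<close>
    in \<open>small\<close>.\<close>
  have "2 \<le> 1 / (4 * h)"
    using h by (simp add: field_simps)
  then have N: "N > 0" "real N \<le> 1 / (4 * h)" "1 / (4 * h) - 1 \<le> real N"
    unfolding N_def by linarith+
  have "1 / (8 * h) \<le> real N"
    using N(3) h by (simp add: field_simps)
  then have N8: "1 \<le> 8 * h * real N"
    using h by (simp add: field_simps)
  have bumps: "z k \<in> {0..1}" "g k (z k) = H" if "k < N" for k
  proof -
    have "h * (2 * real k + 1) \<le> h * (2 * real N)"
      using that h by (intro mult_left_mono) auto
    also have "\<dots> \<le> 1 / 2"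
      using N(2) h by (simp add: field_simps)
    finally show "z k \<in> {0..1}"
      using h by (simp add: z_def)
    show "g k (z k) = H"
      by (simp add: g_def bump_deriv_0)
  qed
  have disj: "{z k - h<..<z k + h} \<inter> {z k' - h<..<z k' + h} = {}" if "k \<noteq> k'" for k k'
  proof -
    have *: "z k + h \<le> z k' - h" if "k < k'" for k k'
    proof -
      have "h * (2 * real k + 2) \<le> h * (2 * real k')"
        using that h by (intro mult_left_mono) auto
      then show ?thesis
        by (simp add: z_def algebra_simps)
    qed
    show ?thesis
      using *[of k k'] *[of k' k] that by (cases "k < k'") auto
  qed
  have energy: "exp (H\<^sup>2 * (2 * h) / s\<^sup>2) \<le> real N * \<delta>\<^sup>2"
  proof -
    have "exp (H\<^sup>2 * (2 * h) / s\<^sup>2) \<le> (8 * h * real N) * exp (H\<^sup>2 * (2 * h) / s\<^sup>2)"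
      using N8 by simp
    also have "\<dots> = real N * (8 * h * exp (H\<^sup>2 * (2 * h) / s\<^sup>2))"
      by simp
    also have "\<dots> \<le> real N * \<delta>\<^sup>2"
      using small unfolding H_def by (intro mult_left_mono) auto
    finally show ?thesis .
  qed
  show ?thesis
    unfolding minimax_length_def H_def[symmetric]
  proof (rule INF_greatest)
    fix C assume C: "C \<in> conf_bands \<Omega> W \<eta> s \<alpha> ?F"
    show "ereal H \<le> worst_length \<Omega> W \<eta> s \<beta> C ?G"
    proof (rule worst_length_lower_bound[where n = N and f = f and g = g and z = z
          and a = "\<lambda>k. z k - h" and b = "\<lambda>k. z k + h" and w = "2 * h" and F = ?F])
      show "continuous_on UNIV f" "\<And>k. continuous_on UNIV (g k)"
        using holder_class_continuous[OF \<open>\<gamma> > 0\<close>] f g_holder by blast+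
      show "f \<in> ?F"
        using f_G G_F by blast
    qed (use bm s N(1) g_le g_out h disj \<delta> energy bumps fg_F f_G G_F C in auto)
  qed
qed

section \<open>Choice of the bandwidth as the noise vanishes\<close>

lemma eventually_small_noise:
  fixes e c :: real
  assumes "e > 0" "c > 0" "d > 0" "\<sigma> > 0"
  shows "\<forall>\<^sub>F n in sequentially. let s = \<sigma> / sqrt (real n) in
    0 < s \<and> s < 1 \<and> (c * (s\<^sup>2 * ln (1 / s))) powr e \<le> 1 / 8 \<and> 8 * (c * (s * ln (1 / s))) powr e \<le> d"
proof -
  have s: "filterlim (\<lambda>n. \<sigma> / sqrt (real n)) (at_right 0) sequentially"
    using assms by real_asymp
  have pos: "\<forall>\<^sub>F s in at_right (0::real). 0 < s \<and> s < 1"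
    by (auto simp: eventually_at_right_field intro: exI[of _ 1])
  have "((\<lambda>s::real. c * (s\<^sup>2 * ln (1 / s))) \<longlongrightarrow> c * 0) (at_right 0)"
    by (intro tendsto_mult_left) real_asymp
  moreover have "\<forall>\<^sub>F s in at_right (0::real). 0 \<le> c * (s\<^sup>2 * ln (1 / s))"
    using pos by eventually_elim (use assms in \<open>auto intro!: mult_nonneg_nonneg\<close>)
  ultimately have 1: "((\<lambda>s::real. (c * (s\<^sup>2 * ln (1 / s))) powr e) \<longlongrightarrow> 0) (at_right 0)"
    using \<open>e > 0\<close> by (intro tendsto_zero_powrI[OF _ tendsto_const]) auto
  have "((\<lambda>s::real. c * (s * ln (1 / s))) \<longlongrightarrow> c * 0) (at_right 0)"
    by (intro tendsto_mult_left) real_asymp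
  moreover have "\<forall>\<^sub>F s in at_right (0::real). 0 \<le> c * (s * ln (1 / s))"
    using pos by eventually_elim (use assms in \<open>auto intro!: mult_nonneg_nonneg\<close>)
  ultimately have 2: "((\<lambda>s::real. (c * (s * ln (1 / s))) powr e) \<longlongrightarrow> 0) (at_right 0)"
    using \<open>e > 0\<close> by (intro tendsto_zero_powrI[OF _ tendsto_const]) auto
  have "\<forall>\<^sub>F s in at_right (0::real). (c * (s\<^sup>2 * ln (1 / s))) powr e < 1 / 8"
    using order_tendstoD(2)[OF 1, of "1 / 8"] by simp
  moreover have "\<forall>\<^sub>F s in at_right (0::real). (c * (s * ln (1 / s))) powr e < d / 8"
    using order_tendstoD(2)[OF 2, of "d / 8"] \<open>d > 0\<close> by simp
  ultimately have "\<forall>\<^sub>F s in at_right (0::real). 0 < s \<and> s < 1 \<and>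
      (c * (s\<^sup>2 * ln (1 / s))) powr e \<le> 1 / 8 \<and> 8 * (c * (s * ln (1 / s))) powr e \<le> d"
    using pos by eventually_elim auto
  from eventually_compose_filterlim[OF this s] show ?thesis
    by (simp add: Let_def)
qed

text \<open>\<open>h powr (2 * \<gamma> + 1)\<close> is proportional to
  \<open>s\<^sup>2 * ln (1 / s)\<close>, so the bump energy is a multiple of
  \<open>ln (1 / s)\<close>. The constant \<open>\<tau>\<close> makes that multiple
  \<open>e\<close>, half of the critical value \<open>2 * e\<close>: up to logarithms
  \<open>h\<close> is of order \<open>s powr (2 * e)\<close>, and the exponential of the energy is
  only \<open>s powr (- e)\<close>. The exponent of \<open>T\<close> in the last identity is
  \<open>1 - 2 * \<gamma> * e = e\<close>.\<close>

lemma bandwidth_identities: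
  fixes \<gamma> T M s :: real
  assumes "\<gamma> > 0" "T > 0" "M > 0" "0 < s" "s < 1"
  defines "e \<equiv> 1 / (2 * \<gamma> + 1)"
  defines "\<tau> \<equiv> 8 * M\<^sup>2 * e"
  defines "h \<equiv> (\<tau> / T\<^sup>2 * (s\<^sup>2 * ln (1 / s))) powr e"
  shows "h > 0"
    and "h * exp ((T / (4 * M) * h powr \<gamma>)\<^sup>2 * (2 * h) / s\<^sup>2) = (\<tau> / T\<^sup>2 * (s * ln (1 / s))) powr e"
    and "T / (4 * M) * h powr \<gamma>
      = \<tau> powr (\<gamma> * e) / (4 * M) * (T powr e * (s\<^sup>2 * ln (1 / s)) powr (\<gamma> * e))"
proof -
  define L where "L = ln (1 / s)"
  have L: "L > 0"
    using assms by (simp add: L_def)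
  have e: "e > 0" "e * (2 * \<gamma> + 1) = 1"
    using \<open>\<gamma> > 0\<close> by (auto simp: e_def)
  have \<tau>: "\<tau> > 0"
    using assms(3) e by (simp add: \<tau>_def)
  have h_eq: "h = (\<tau> / T\<^sup>2 * (s\<^sup>2 * L)) powr e"
    by (simp add: h_def L_def)
  show h: "h > 0"
    unfolding h_eq using \<tau> L assms by simp
  have "h powr (2 * \<gamma> + 1) = \<tau> / T\<^sup>2 * (s\<^sup>2 * L)"
    using \<tau> L assms(2,4) e by (simp add: h_eq powr_powr)
  moreover have "(h powr \<gamma>)\<^sup>2 * h = h powr (\<gamma> + (\<gamma> + 1))"
    unfolding powr_add using h by (simp add: power2_eq_square)
  ultimately have hh: "(h powr \<gamma>)\<^sup>2 * h = \<tau> / T\<^sup>2 * (s\<^sup>2 * L)"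
    by (simp only: mult_2 add.assoc)
  have "(T / (4 * M) * h powr \<gamma>)\<^sup>2 * (2 * h) / s\<^sup>2 = T\<^sup>2 / (8 * M\<^sup>2 * s\<^sup>2) * ((h powr \<gamma>)\<^sup>2 * h)"
    by (simp add: power_mult_distrib power_divide)
  also have "\<dots> = e * L"
    unfolding hh \<tau>_def using assms(2-4) by simp
  finally have "exp ((T / (4 * M) * h powr \<gamma>)\<^sup>2 * (2 * h) / s\<^sup>2) = (1 / s) powr e"
    using assms(4) by (simp add: powr_def L_def)
  moreover have "h * (1 / s) powr e = (\<tau> / T\<^sup>2 * (s * L)) powr e"
    using \<tau> L assms(2,4) unfolding h_eq by (simp add: power2_eq_square flip: powr_mult)
  ultimately show "h * exp ((T / (4 * M) * h powr \<gamma>)\<^sup>2 * (2 * h) / s\<^sup>2)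
      = (\<tau> / T\<^sup>2 * (s * ln (1 / s))) powr e"
    by (simp add: L_def)
  have "h powr \<gamma> = (\<tau> / T\<^sup>2 * (s\<^sup>2 * L)) powr (\<gamma> * e)"
    by (simp add: h_eq powr_powr mult.commute)
  also have "\<dots> = \<tau> powr (\<gamma> * e) / (T\<^sup>2) powr (\<gamma> * e) * (s\<^sup>2 * L) powr (\<gamma> * e)"
    using \<tau> L assms(2,4) by (simp add: powr_mult powr_divide)
  finally have "T / (4 * M) * h powr \<gamma>
      = \<tau> powr (\<gamma> * e) / (4 * M) * (T / (T\<^sup>2) powr (\<gamma> * e) * (s\<^sup>2 * L) powr (\<gamma> * e))"
    by simp
  also have "T / (T\<^sup>2) powr (\<gamma> * e) = T powr e"
  proof -
    have "(T\<^sup>2) powr (\<gamma> * e) = T powr (2 * \<gamma> * e)"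
      using assms(2) by (simp add: powr_powr mult.assoc flip: powr_numeral)
    moreover have "T = T powr (e + 2 * \<gamma> * e)"
      using e(2) assms(2) by (simp add: algebra_simps)
    ultimately show ?thesis
      using assms(2) by (metis add_diff_cancel_right' powr_diff)
  qed
  finally show "T / (4 * M) * h powr \<gamma>
      = \<tau> powr (\<gamma> * e) / (4 * M) * (T powr e * (s\<^sup>2 * ln (1 / s)) powr (\<gamma> * e))"
    by (simp add: L_def)
qed

theorem theorem2p1:
  fixes \<gamma> :: real and K :: "real \<Rightarrow> real \<Rightarrow> real"
  assumes "\<gamma> > 0"
    and "kernel K"
    and "\<exists>C\<^sub>K. \<forall>x y. \<bar>x - y\<bar> > C\<^sub>K \<longrightarrow> K y x = 0"
    and "\<forall>(k::int) x y. K y x = K (y - of_int k) (x - of_int k)"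
  shows "\<exists>(j\<^sub>0::int) (C\<^sub>0::real) (\<eta>\<^sub>0::real). C\<^sub>0 > 0 \<and> \<eta>\<^sub>0 > 0 \<and>
    (\<forall>(M :: 'a measure) (W :: real \<Rightarrow> 'a \<Rightarrow> real) (\<eta>::real) (\<sigma>::real) (\<alpha>::real) (\<beta>::real)
       (Bl::real) (B::real) (Bu::real) (\<epsilon>::real) (\<epsilon>'::real) (l::int).
       two_sided_brownian_motion M W \<longrightarrow> \<eta> > 0 \<longrightarrow> \<sigma> > 0 \<longrightarrow>
       0 < 2 * \<alpha> \<longrightarrow> 2 * \<alpha> < \<beta> \<longrightarrow> \<beta> < 1 \<longrightarrow>
       0 < Bl \<longrightarrow> Bl \<le> B \<longrightarrow> B \<le> Bu \<longrightarrow>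
       0 < \<epsilon> \<longrightarrow> \<epsilon> \<le> \<epsilon>' \<longrightarrow> \<epsilon>' < \<eta>\<^sub>0 \<longrightarrow> l \<ge> j\<^sub>0 \<longrightarrow>
       (\<exists>r :: nat \<Rightarrow> real. r \<longlonglongrightarrow> 0 \<and>
          (\<forall>\<^sub>F n in sequentially.
             (let \<sigma>\<^sub>n = \<sigma> / sqrt (real n) in
              minimax_length M W \<eta> \<sigma>\<^sub>n \<alpha> \<beta>
                (self_sim_class \<gamma> B \<epsilon>' K l)
                (\<Union>B'\<in>{Bl..Bu}. self_sim_class \<gamma> B' \<epsilon> K l)
              \<ge> ereal ((1 + r n) * C\<^sub>0 * min (B / \<epsilon>) Bu powr (1 / (2 * \<gamma> + 1)) *
                       (\<sigma>\<^sub>n\<^sup>2 * ln (1 / \<sigma>\<^sub>n)) powr (\<gamma> / (2 * \<gamma> + 1)))))))"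
proof -
  obtain j\<^sub>0 \<kappa> where \<kappa>: "0 < \<kappa>" "\<kappa> \<le> 1"
    and sim: "\<forall>B>0. \<exists>f\<in>holder_class \<gamma> (B / 2). \<forall>g j. j\<^sub>0 \<le> j \<longrightarrow> (\<forall>x\<le>1/2. g x = 0) \<longrightarrow>
       (\<exists>t\<in>{0..1}. \<kappa> * B * 2 powr (- (of_int j * \<gamma>)) \<le> \<bar>kernel_op K j (\<lambda>x. f x + g x) t - (f t + g t)\<bar>)"
    by (rule self_similar_function[OF assms])
  define A where "A = bump_bound (strict_floor \<gamma>)"
  have A: "A > 0"
    using bump_bound_ge_1[of "strict_floor \<gamma>"] by (simp add: A_def)
  define e where "e = 1 / (2 * \<gamma> + 1)"
  have e: "e > 0"
    using \<open>\<gamma> > 0\<close> by (simp add: e_def)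
  \<comment> \<open>\<open>\<tau>\<close> and the first factor of \<open>C\<^sub>0\<close> are those
    of \<open>bandwidth_identities\<close>; the factor \<open>\<kappa> powr e\<close> pays for
    replacing \<open>T\<close> by its lower bound
    \<open>\<kappa> * min (B / \<epsilon>) Bu\<close>.\<close>
  define \<tau> where "\<tau> = 8 * A\<^sup>2 * e"
  define C\<^sub>0 where "C\<^sub>0 = \<tau> powr (\<gamma> * e) / (4 * A) * \<kappa> powr e"
  have \<tau>: "\<tau> > 0"
    using A e by (simp add: \<tau>_def)
  have C\<^sub>0: "C\<^sub>0 > 0"
    using \<tau> A \<kappa> by (simp add: C\<^sub>0_def)
  show ?thesis
  proof (intro exI conjI allI impI)
    show "C\<^sub>0 > 0" "\<kappa> > 0"
      by fact+
    fix M :: "'a measure" and W and \<eta> \<sigma> \<alpha> \<beta> Bl B Bu \<epsilon> \<epsilon>' :: real and l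
    assume bm: "two_sided_brownian_motion M W" and "\<sigma> > 0" "2 * \<alpha> < \<beta>"
      and B: "0 < Bl" "Bl \<le> B" "B \<le> Bu" and \<epsilon>: "0 < \<epsilon>" "\<epsilon> \<le> \<epsilon>'" "\<epsilon>' < \<kappa>" and "j\<^sub>0 \<le> l"
    \<comment> \<open>With \<open>\<kappa>\<close> as \<open>\<eta>\<^sub>0\<close>, the condition
      \<open>\<epsilon>' < \<kappa>\<close> places \<open>f\<close> in the smaller class, and
      \<open>\<epsilon> < \<kappa>\<close> gives \<open>B \<le> T\<close>.\<close>
    define T where "T = min (\<kappa> * B / \<epsilon>) Bu"
    have T: "B \<le> T" "T \<le> Bu" "\<epsilon> * T \<le> \<kappa> * B" "\<kappa> * min (B / \<epsilon>) Bu \<le> T"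
    proof -
      have "B * \<epsilon> \<le> B * \<kappa>"
        using B \<epsilon> by (intro mult_left_mono) auto
      then show "B \<le> T"
        using B \<epsilon> by (simp add: T_def field_simps)
      show "T \<le> Bu"
        by (simp add: T_def)
      have "\<epsilon> * T \<le> \<epsilon> * (\<kappa> * B / \<epsilon>)"
        using \<epsilon> by (intro mult_left_mono) (auto simp: T_def)
      then show "\<epsilon> * T \<le> \<kappa> * B"
        using \<epsilon> by simp
      have "\<kappa> * min (B / \<epsilon>) Bu \<le> \<kappa> * (B / \<epsilon>)"
        using \<kappa> by (intro mult_left_mono) auto
      moreover have "\<kappa> * min (B / \<epsilon>) Bu \<le> 1 * Bu"
        using \<kappa> B \<epsilon> by (intro mult_mono) auto
      ultimately show "\<kappa> * min (B / \<epsilon>) Bu \<le> T"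
        by (simp add: T_def)
    qed
    have "T > 0"
      using T B by simp
    define \<delta> where "\<delta> = (\<beta> - 2 * \<alpha>) / 2"
    have \<delta>: "\<delta> > 0" "2 * \<alpha> + \<delta> < \<beta>"
      using \<open>2 * \<alpha> < \<beta>\<close> by (simp_all add: \<delta>_def field_simps)
    have "B > 0"
      using B by simp
    from sim[THEN spec, THEN mp, OF this] obtain f where f: "f \<in> holder_class \<gamma> (B / 2)"
      "\<forall>g j. j\<^sub>0 \<le> j \<longrightarrow> (\<forall>x\<le>1/2. g x = 0) \<longrightarrow> (\<exists>t\<in>{0..1}.
         \<kappa> * B * 2 powr (- (of_int j * \<gamma>)) \<le> \<bar>kernel_op K j (\<lambda>x. f x + g x) t - (f t + g t)\<bar>)"
      by (rule bexE)
    \<comment> \<open>The bound holds without an error term once \<open>n\<close> is large, so the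
      vanishing sequence can be 0.\<close>
    show "(\<lambda>_::nat. 0::real) \<longlonglongrightarrow> 0"
      by simp
    have "\<forall>\<^sub>F n in sequentially. let s = \<sigma> / sqrt (real n) in 0 < s \<and> s < 1 \<and>
        (\<tau> / T\<^sup>2 * (s\<^sup>2 * ln (1 / s))) powr e \<le> 1 / 8 \<and> 8 * (\<tau> / T\<^sup>2 * (s * ln (1 / s))) powr e \<le> \<delta>\<^sup>2"
      using e \<tau> \<open>T > 0\<close> \<delta> \<open>\<sigma> > 0\<close> by (intro eventually_small_noise) auto
    then show "\<forall>\<^sub>F n in sequentially. let \<sigma>\<^sub>n = \<sigma> / sqrt (real n) in
        ereal ((1 + 0) * C\<^sub>0 * min (B / \<epsilon>) Bu powr (1 / (2 * \<gamma> + 1)) *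
          (\<sigma>\<^sub>n\<^sup>2 * ln (1 / \<sigma>\<^sub>n)) powr (\<gamma> / (2 * \<gamma> + 1)))
        \<le> minimax_length M W \<eta> \<sigma>\<^sub>n \<alpha> \<beta> (self_sim_class \<gamma> B \<epsilon>' K l)
            (\<Union>B'\<in>{Bl..Bu}. self_sim_class \<gamma> B' \<epsilon> K l)"
    proof eventually_elim
      case (elim n)
      define s where "s = \<sigma> / sqrt (real n)"
      define h where "h = (\<tau> / T\<^sup>2 * (s\<^sup>2 * ln (1 / s))) powr e"
      have s: "0 < s" "s < 1" "h \<le> 1 / 8" "8 * (\<tau> / T\<^sup>2 * (s * ln (1 / s))) powr e \<le> \<delta>\<^sup>2"
        using elim unfolding Let_def s_def h_def by blast+
      note h = bandwidth_identities[OF \<open>\<gamma> > 0\<close> \<open>T > 0\<close> A s(1,2), folded e_def, folded \<tau>_def, folded h_def]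
      have le: "C\<^sub>0 * min (B / \<epsilon>) Bu powr e * (s\<^sup>2 * ln (1 / s)) powr (\<gamma> * e) \<le> T / (4 * A) * h powr \<gamma>"
      proof -
        have "\<kappa> powr e * min (B / \<epsilon>) Bu powr e = (\<kappa> * min (B / \<epsilon>) Bu) powr e"
          using \<kappa> B \<epsilon> by (simp add: powr_mult)
        also have "\<dots> \<le> T powr e"
          using T(4) e \<kappa> B \<epsilon> by (intro powr_mono2) auto
        finally have "\<tau> powr (\<gamma> * e) / (4 * A) * (\<kappa> powr e * min (B / \<epsilon>) Bu powr e * (s\<^sup>2 * ln (1 / s)) powr (\<gamma> * e))
          \<le> \<tau> powr (\<gamma> * e) / (4 * A) * (T powr e * (s\<^sup>2 * ln (1 / s)) powr (\<gamma> * e))"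
          using A by (intro mult_left_mono mult_right_mono) auto
        then show ?thesis
          unfolding h(3) C\<^sub>0_def by (simp only: mult.assoc)
      qed
      have "ereal (T / (4 * A) * h powr \<gamma>) \<le> minimax_length M W \<eta> s \<alpha> \<beta> (self_sim_class \<gamma> B \<epsilon>' K l)
          (\<Union>B'\<in>{Bl..Bu}. self_sim_class \<gamma> B' \<epsilon> K l)"
        unfolding A_def
      proof (rule minimax_length_lower_bound[where T = T and \<kappa> = \<kappa> and f = f and \<delta> = \<delta>])
        show "8 * h * exp ((T / (4 * bump_bound (strict_floor \<gamma>)) * h powr \<gamma>)\<^sup>2 * (2 * h) / s\<^sup>2) \<le> \<delta>\<^sup>2"
          using s(4) unfolding A_def[symmetric] mult.assoc[of 8] h(2) .
        show "\<exists>t\<in>{0..1}. \<kappa> * B * 2 powr (- (of_int j * \<gamma>))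
            \<le> \<bar>kernel_op K j (\<lambda>x. f x + g x) t - (f t + g t)\<bar>"
          if "j\<^sub>0 \<le> j" "\<forall>x\<le>1/2. g x = 0" for g j
          using f(2) that by blast
      qed (use \<open>\<gamma> > 0\<close> bm s f(1) B T \<epsilon> \<open>j\<^sub>0 \<le> l\<close> h(1) \<delta> in auto)
      with le have "ereal (C\<^sub>0 * min (B / \<epsilon>) Bu powr e * (s\<^sup>2 * ln (1 / s)) powr (\<gamma> * e))
          \<le> minimax_length M W \<eta> s \<alpha> \<beta> (self_sim_class \<gamma> B \<epsilon>' K l)
            (\<Union>B'\<in>{Bl..Bu}. self_sim_class \<gamma> B' \<epsilon> K l)"
        by (meson ereal_less_eq(3) order_trans)
      then show ?case
        by (simp add: Let_def s_def e_def)
    qed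
  qed
qed

end
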